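(* Let $G$ be a discrete group with a norm $\|\cdot\|$ such that its volume function $V$ is doubling and $\|\cdot\|$ is well-connected. Let $r$ be a positive continuous increasing doubling function. Let $\nu$ be a symmetric probability measure on $G$ that is $(\|\cdot\|,r)$-controlled and satisfies $\nu(e)>0$ and a pointwise $(\|\cdot\|,r)$-pseudo-Poincaré inequality. Then $\nu$ is also strongly $(\|\cdot\|,r)$-controlled.
   Context: A norm on $G$ is a function $\|\cdot\|:G\to[0,\infty)$ with $\|g\|=0$ iff $g=e$ and $\|gh\|\le\|g\|+\|h\|$; its volume function is $V(t)=\#\{g:\|g\|\le t\}$; $d(x,y)=\|x^{-1}y\|$ is a distance function on $G$. A positive function $f$ is doubling if $f(2t)\le Cf(t)$ for some constant $C$ and all $t>0$. $f\simeq g$ means $cg\le f\le Cg$ for constants $0<c\le C<\infty$. A measure is symmetric if $\nu(g)=\nu(g^{-1})$. Well-connected: there exists $b\in(0,\infty)$ such that, for any $t>0$ and $x\in G$ with $\|x\|\le t$, there exists a finite sequence $(x_i)_0^N$ in $G$ with $x_0=e$, $x_N=x$, $\|x_i\|\le2t$ and $\|x_i^{-1}x_{i+1}\|\le b$ ($N$ may depend on $x$ with no required bound). Pseudo-Poincaré: with $\rho$ the inverse of $r$, $\nu$ satisfies a pointwise $(\|\cdot\|,r)$-pseudo-Poincaré inequality if there is a constant $C$ such that for any finitely supported $f$ on $G$ and all $g\in G$, $\sum_{x\in G}|f(xg)-f(x)|^2\le C\rho(\|g\|)\mathcal E_\nu(f,f)$, where $\mathcal E_\nu(f,f)=\frac12\sum_{x,y}(f(x)-f(y))^2\nu(x^{-1}y)$.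 For a probability measure $\mu$ on $G$, $\mu^{(n)}$ is the $n$-fold convolution power; the random walk driven by $\mu$ is $X_n=X_0\xi_1\cdots\xi_n$ with $(\xi_i)$ i.i.d. of law $\mu$; $\mathbf P_x$ is its law when $X_0=x$. Control: a symmetric $\mu$ is $(\|\cdot\|,r)$-controlled if (1) for all $n$, $\mu^{(2n)}(e)\simeq V(r(n))^{-1}$; (2) for all $\epsilon>0$ there exists $\gamma\in(0,\infty)$ such that $\mathbf P_e(\sup_{0\le k\le n}\|X_k\|\ge\gamma r(n))\le\epsilon$ (for all $n$). Strong control: let $r:(0,\infty)\to(0,\infty)$ be an increasing continuous function with inverse $\rho$. A symmetric probability measure $\mu$ on $G$ is strongly $(\|\cdot\|,r)$-controlled if: (1) there exists $C\in(0,\infty)$ and, for any $\kappa>0$, there exists $c(\kappa)>0$ such that, for all $n\ge1$ and all $g$ with $\|g\|\le\kappa r(n)$, $c(\kappa)V(r(n))^{-1}\le\mu^{(2n)}(g)\le CV(r(n))^{-1}$; (2) there exist $\epsilon,\gamma_1,\gamma_2\in(0,\infty)$, $\gamma_2\ge1$, such that, for all $n,\tau$ with $\frac12\rho(\tau/\gamma_1)\le n\le\rho(\tau/\gamma_1)$, $\inf_{x:\|x\|\le\tau}\mathbf P_x\big(\sup_{0\le k\le n}\|X_k\|\le\gamma_2\tau;\ \|X_n\|\le\tau\big)\ge\epsilon$.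
   Formalization: As stated, (1) at n=1 with large κ forces ν^(2)(g)>0 for all g, which fails for lazy simple walk on Z; the lower bound in (1) is proved for n≥n0(κ), and for all n≥1 when ν^(2) charges every g. r is taken to be a bijection of (0,∞), so that ρ is defined. *)

theory Defs
  imports "HOL-Probability.Probability"
begin

text \<open>
  Groups are types of class \<open>group_add\<close>, which is not assumed commutative: the group law is
  written additively, so $e$ is \<open>0\<close>, $gh$ is \<open>g + h\<close> and $x^{-1}y$ is \<open>- x + y\<close>.
  Functions on $(0,\infty)$ are total functions on the reals of which only the values on
  \<open>{0<..}\<close> are used.
\<close>

definition group_norm :: "('a::group_add \<Rightarrow> real) \<Rightarrow> bool" where
  "group_norm nm \<longleftrightarrow>
     (\<forall>g. 0 \<le> nm g) \<and> (\<forall>g. nm g = 0 \<longleftrightarrow> g = 0) \<and> (\<forall>g h. nm (g + h) \<le> nm g + nm h)"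

definition volume_fun :: "('a \<Rightarrow> real) \<Rightarrow> real \<Rightarrow> real" where
  "volume_fun nm t = real (card {g. nm g \<le> t})"

text \<open>
  Positivity is part of the definition. As the cardinality of an infinite set is \<open>0\<close>, a doubling
  volume function means in particular that all balls are finite (so the group is countable).
\<close>

definition doubling :: "(real \<Rightarrow> real) \<Rightarrow> bool" where
  "doubling f \<longleftrightarrow> (\<exists>C. \<forall>t>0. 0 < f t \<and> f (2 * t) \<le> C * f t)"

definition well_connected :: "('a::group_add \<Rightarrow> real) \<Rightarrow> bool" where
  "well_connected nm \<longleftrightarrow>
     (\<exists>b>0. \<forall>t>0. \<forall>x. nm x \<le> t \<longrightarrow>
        (\<exists>(N::nat) (xs :: nat \<Rightarrow> 'a).
            xs 0 = 0 \<and> xs N = x \<and> (\<forall>i\<le>N. nm (xs i) \<le> 2 * t) \<and>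
            (\<forall>i<N. nm (- xs i + xs (Suc i)) \<le> b)))"

text \<open>
  An increasing continuous $r : (0,\infty) \to (0,\infty)$ possessing an inverse
  $(0,\infty) \to (0,\infty)$.
\<close>

definition scale_function :: "(real \<Rightarrow> real) \<Rightarrow> bool" where
  "scale_function r \<longleftrightarrow>
     strict_mono_on {0<..} r \<and> continuous_on {0<..} r \<and> bij_betw r {0<..} {0<..}"

text \<open>
  The inverse $\rho$ of $r$, with the convention $\rho(0) = 0$ (relevant only for $\|g\| = 0$ in the
  pseudo-Poincare inequality, whose left-hand side then vanishes).
\<close>

definition inverse_scale :: "(real \<Rightarrow> real) \<Rightarrow> real \<Rightarrow> real" where
  "inverse_scale r s = (if 0 < s then inv_into {0<..} r s else 0)"

definition symmetric_pmf :: "'a::group_add pmf \<Rightarrow> bool" where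
  "symmetric_pmf \<mu> \<longleftrightarrow> (\<forall>g. pmf \<mu> g = pmf \<mu> (- g))"

definition convolve :: "'a::group_add pmf \<Rightarrow> 'a pmf \<Rightarrow> 'a pmf" where
  "convolve p q = map_pmf (\<lambda>(x, y). x + y) (pair_pmf p q)"

primrec conv_power :: "nat \<Rightarrow> 'a::group_add pmf \<Rightarrow> 'a pmf" where
  "conv_power 0 \<mu> = return_pmf 0"
| "conv_power (Suc n) \<mu> = convolve (conv_power n \<mu>) \<mu>"

text \<open>
  The random walk started at \<open>x\<close> with increments \<open>\<omega> !! 0, \<omega> !! 1, \<dots>\<close>; under
  \<open>stream_space (measure_pmf \<mu>)\<close> the increments are i.i.d. with law \<open>\<mu>\<close>.
\<close>

definition walk :: "'a::group_add \<Rightarrow> nat \<Rightarrow> 'a stream \<Rightarrow> 'a" where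
  "walk x k \<omega> = x + sum_list (stake k \<omega>)"

definition steps :: "'a pmf \<Rightarrow> 'a stream measure" where
  "steps \<mu> = stream_space (measure_pmf \<mu>)"

definition comparable_on :: "'i set \<Rightarrow> ('i \<Rightarrow> real) \<Rightarrow> ('i \<Rightarrow> real) \<Rightarrow> bool" where
  "comparable_on I f g \<longleftrightarrow>
     (\<exists>c C. 0 < c \<and> c \<le> C \<and> (\<forall>i\<in>I. c * g i \<le> f i \<and> f i \<le> C * g i))"

definition dirichlet_form :: "'a::group_add pmf \<Rightarrow> ('a \<Rightarrow> real) \<Rightarrow> real" where
  "dirichlet_form \<nu> f =
     (1/2) * (\<Sum>\<^sub>\<infinity>(x, y)\<in>UNIV. (f x - f y)\<^sup>2 * pmf \<nu> (- x + y))"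

definition pseudo_poincare ::
  "('a::group_add \<Rightarrow> real) \<Rightarrow> (real \<Rightarrow> real) \<Rightarrow> 'a pmf \<Rightarrow> bool" where
  "pseudo_poincare nm r \<nu> \<longleftrightarrow>
     (\<exists>C. \<forall>f :: 'a \<Rightarrow> real. finite {x. f x \<noteq> 0} \<longrightarrow>
        (\<forall>g. (\<Sum>\<^sub>\<infinity>x\<in>UNIV. \<bar>f (x + g) - f x\<bar>\<^sup>2)
               \<le> C * inverse_scale r (nm g) * dirichlet_form \<nu> f))"

definition controlled ::
  "('a::group_add \<Rightarrow> real) \<Rightarrow> (real \<Rightarrow> real) \<Rightarrow> 'a pmf \<Rightarrow> bool" where
  "controlled nm r \<mu> \<longleftrightarrow>
     comparable_on {1::nat..} (\<lambda>n. pmf (conv_power (2 * n) \<mu>) 0)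
       (\<lambda>n. inverse (volume_fun nm (r (real n)))) \<and>
     (\<forall>\<epsilon>>0. \<exists>\<gamma>>0. \<forall>n\<ge>1.
        measure (steps \<mu>)
          {\<omega>\<in>space (steps \<mu>). (SUP k\<in>{0..n}. nm (walk 0 k \<omega>)) \<ge> \<gamma> * r (real n)} \<le> \<epsilon>)"

text \<open>
  Strong control, with the lower bound in the first condition imposed only for \<open>n \<ge> n0 \<kappa>\<close>.
  The usual notion, with all \<open>n \<ge> 1\<close>, is the case \<open>n0 \<kappa> = 1\<close> below. It forces
  $\mu^{(2)}$ to charge every element of the group (take $n = 1$ and $\kappa$ large), so a walk with
  bounded steps on an infinite group can satisfy it only for \<open>n \<ge> n0 \<kappa>\<close>.
\<close>

definition strongly_controlled_from ::
  "(real \<Rightarrow> nat) \<Rightarrow> ('a::group_add \<Rightarrow> real) \<Rightarrow> (real \<Rightarrow> real) \<Rightarrow> 'a pmf \<Rightarrow> bool" where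
  "strongly_controlled_from n0 nm r \<mu> \<longleftrightarrow>
     (\<exists>C>0. \<forall>\<kappa>>0. \<exists>c>0. \<forall>n\<ge>1. \<forall>g. nm g \<le> \<kappa> * r (real n) \<longrightarrow>
        (n0 \<kappa> \<le> n \<longrightarrow>
           c * inverse (volume_fun nm (r (real n))) \<le> pmf (conv_power (2 * n) \<mu>) g) \<and>
        pmf (conv_power (2 * n) \<mu>) g \<le> C * inverse (volume_fun nm (r (real n)))) \<and>
     (\<exists>\<epsilon>>0. \<exists>\<gamma>1>0. \<exists>\<gamma>2\<ge>1. \<forall>n::nat. \<forall>\<tau>>0.
        (1/2) * inverse_scale r (\<tau> / \<gamma>1) \<le> real n \<and> real n \<le> inverse_scale r (\<tau> / \<gamma>1) \<longrightarrow>
        (INF x\<in>{x. nm x \<le> \<tau>}.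
           measure (steps \<mu>)
             {\<omega>\<in>space (steps \<mu>).
                (SUP k\<in>{0..n}. nm (walk x k \<omega>)) \<le> \<gamma>2 * \<tau> \<and> nm (walk x n \<omega>) \<le> \<tau>})
          \<ge> \<epsilon>)"

definition strongly_controlled ::
  "('a::group_add \<Rightarrow> real) \<Rightarrow> (real \<Rightarrow> real) \<Rightarrow> 'a pmf \<Rightarrow> bool" where
  "strongly_controlled nm r \<mu> \<longleftrightarrow> strongly_controlled_from (\<lambda>\<kappa>. 1) nm r \<mu>"

lemma strongly_controlled_imp_full_support:
  assumes "doubling (volume_fun nm)" and "0 < r 1" and "strongly_controlled nm r \<mu>"
  shows "0 < pmf (conv_power 2 \<mu>) g"
proof -
  define \<kappa> where "\<kappa> = max 1 (nm g / r 1)"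
  have \<kappa>: "\<kappa> > 0" and g: "nm g \<le> \<kappa> * r 1"
    using assms(2) by (auto simp: \<kappa>_def max_def field_simps)
  have "\<forall>\<kappa>>0. \<exists>c>0. \<forall>n\<ge>1. \<forall>g. nm g \<le> \<kappa> * r (real n) \<longrightarrow>
      c * inverse (volume_fun nm (r (real n))) \<le> pmf (conv_power (2 * n) \<mu>) g"
    using assms(3) unfolding strongly_controlled_def strongly_controlled_from_def by meson
  then obtain c where c: "c > 0" and low: "\<forall>n\<ge>1. \<forall>g. nm g \<le> \<kappa> * r (real n) \<longrightarrow>
      c * inverse (volume_fun nm (r (real n))) \<le> pmf (conv_power (2 * n) \<mu>) g"
    using \<kappa> by blast
  have "c * inverse (volume_fun nm (r 1)) \<le> pmf (conv_power 2 \<mu>) g"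
    using low[rule_format, of 1 g] g by simp
  moreover have "0 < volume_fun nm (r 1)"
    using assms(1,2) by (auto simp: doubling_def)
  ultimately show ?thesis
    using c by (smt (verit) mult_pos_pos positive_imp_inverse_positive)
qed

end

theory Submission
  imports Defs
begin

text \<open>
  Write $p_n$ for the density of $\nu^{(n)}$ and $W(n) = V(r(n))$. The upper bound in strong control
  is Cauchy-Schwarz, $p_{2n}(g) \le p_{2n}(e)$. Everything else rests on a lower bound
  $p_{2n}(g) \ge c(\kappa) / W(n)$ for $\|g\| \le \kappa r(n)$ and $n$ large, which is obtained in
  three steps.

  Close to the origin (\<open>near_diagonal\<close>). By symmetry $2 (p_{2n}(e) - p_{2n}(g))$ is the
  left-hand side of the pseudo-Poincare inequality for $f = p_n$, while
  $\mathcal E_\nu(p_n, p_n) = p_{2n}(e) - p_{2n+1}(e)$. Since $\nu(e) > 0$, the latter is at most a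
  constant times $p_{2n}(e) - p_{2n+2}(e)$, and because $n \mapsto p_{2n}(e)$ is convex and
  decreasing this is $O(1 / (n W(n)))$. Hence
  $p_{2n}(e) - p_{2n}(g) \le C \rho(\|g\|) / (n W(n))$, which is small compared with $p_{2n}(e)$
  as soon as $\|g\| \le \delta r(n)$.

  Far away, but late (\<open>chaining\<close>). A point with $\|g\| \le \kappa r(n)$ is joined to $e$ by a
  chain of balls of radius comparable to $r(n)$ in which consecutive balls meet, and by doubling a
  shortest such chain has a length bounded in terms of $\kappa$ alone. Multiplying near-diagonal
  bounds along the chain gives $p_{2nL}(g) \ge c / W(n)$ with $L = L(\kappa)$. One cannot simply
  replace $n$ by $n / L$: well-connectedness does not bound the length of chains linearly, and
  shrinking the balls to radius $\delta r(n / L)$ may lengthen the chain by more than was gained.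

  Back in time (\<open>time_extrapolation\<close>, \<open>full_lower_bound\<close>). The idea is that of Varopoulos and
  Carne: $x^N$ is the average of the Chebyshev polynomials $T_{|S_N|}$ over a simple random walk
  $S$ on the integers, and $|S_N| > d$ has probability at most $N / d^2$. Applied to convolution by
  $p_s$, which is a self-adjoint contraction of $\ell^2$, this expresses the density at time
  $2n + sN$ through the densities at times $2n + si$ with $i \le d$, up to an error
  $(N / d^2) p_{2n}(e)$. With $N = (L - 1) d$ and $d$ large this error is smaller than the chaining
  bound, so that one of the early densities has to be of order $1 / W(n)$ as well. A final
  convolution with the near-diagonal bound replaces the unknown early time by a fixed one.

  For the confinement condition, the lower bound is summed over the end points in the ball of
  radius $\tau$, which gives a probability bounded below of ending there (\<open>stay_in_ball\<close>); the
  tightness contained in control removes, at the cost of half of this probability, the paths which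
  go far away (\<open>prob_confined\<close>). Finally, if $\nu^{(2)}$ charges every element, then the finitely
  many pairs $(n, g)$ with $n$ below the threshold are harmless (\<open>full_support_lower_bound\<close>).

  The norm may take very different values at $g$ and $-g$. What replaces its symmetry is
  $p_n(-g) = p_n(g)$, used in \<open>difference_lower_bound\<close>.
\<close>

section \<open>Doubling functions\<close>

lemma doubling_mono_dilation:
  fixes f :: "real \<Rightarrow> real"
  assumes "doubling f" and mono: "\<And>s t. 0 < s \<Longrightarrow> s \<le> t \<Longrightarrow> f s \<le> f t"
    and "a > 0"
  obtains C where "C \<ge> 1" and "\<And>t. t > 0 \<Longrightarrow> f (a * t) \<le> C * f t"
proof -
  obtain C0 where C0: "\<And>t. t > 0 \<Longrightarrow> 0 < f t \<and> f (2 * t) \<le> C0 * f t"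
    using assms(1) unfolding doubling_def by blast
  have "C0 \<ge> 1"
  proof -
    have "f 1 \<le> f 2" using mono by simp
    also have "\<dots> \<le> C0 * f 1" using C0[of 1] by simp
    finally show ?thesis using C0[of 1] by simp
  qed
  have pow: "f (2 ^ k * t) \<le> C0 ^ k * f t" if "t > 0" for k :: nat and t
  proof (induction k)
    case (Suc k)
    have "f (2 * (2 ^ k * t)) \<le> C0 * f (2 ^ k * t)" using C0 that by simp
    also have "\<dots> \<le> C0 * (C0 ^ k * f t)"
      using Suc \<open>C0 \<ge> 1\<close> by (intro mult_left_mono) auto
    finally show ?case by (simp add: mult_ac)
  qed simp
  obtain k :: nat where k: "a < 2 ^ k" using real_arch_pow[of 2 a] by auto
  show ?thesis
  proof (rule that[of "C0 ^ k"])
    show "C0 ^ k \<ge> 1" using \<open>C0 \<ge> 1\<close> by (rule one_le_power)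
    show "f (a * t) \<le> C0 ^ k * f t" if "t > 0" for t
    proof -
      have "f (a * t) \<le> f (2 ^ k * t)"
        using \<open>a > 0\<close> that k by (intro mono mult_right_mono) auto
      with pow[OF that, of k] show ?thesis by simp
    qed
  qed
qed

section \<open>Convolution powers\<close>

lemma convolve_assoc: "convolve (convolve p q) w = convolve p (convolve q w)"
  unfolding convolve_def pair_pmf_def map_pmf_def
  by (simp add: bind_assoc_pmf bind_return_pmf add.assoc)

lemma convolve_return_right [simp]: "convolve p (return_pmf 0) = p"
  unfolding convolve_def pair_pmf_def map_pmf_def
  by (simp add: bind_assoc_pmf bind_return_pmf bind_return_pmf')

lemma convolve_return_left [simp]: "convolve (return_pmf 0) p = p"
  unfolding convolve_def pair_pmf_def map_pmf_def
  by (simp add: bind_assoc_pmf bind_return_pmf bind_return_pmf')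

lemma conv_power_add: "conv_power (m + n) p = convolve (conv_power m p) (conv_power n p)"
  by (induction n) (simp_all add: convolve_assoc)

lemma conv_power_1 [simp]: "conv_power (Suc 0) p = p"
  by simp

lemma has_sum_pmf: "(pmf p has_sum 1) UNIV"
proof -
  have "Infinite_Sum.abs_summable_on (pmf p) UNIV"
    unfolding abs_summable_equivalent by (rule pmf_abs_summable)
  then have "pmf p summable_on UNIV" by (rule abs_summable_summable)
  moreover have "infsum (pmf p) UNIV = 1"
    using infsetsum_pmf_eq_1[of p UNIV] infsetsum_infsum[OF pmf_abs_summable, of p UNIV] by simp
  ultimately show ?thesis by (simp add: has_sum_iff)
qed

lemma has_sum_pmf_expectation:
  assumes "\<And>x. \<bar>f x\<bar> \<le> B"
  shows "((\<lambda>x. pmf p x * f x) has_sum measure_pmf.expectation p f) UNIV"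
proof -
  have "Infinite_Sum.abs_summable_on (\<lambda>x. B * pmf p x) UNIV"
    using summable_on_cmult_right[OF has_sum_imp_summable[OF has_sum_pmf[of p]], of "\<bar>B\<bar>"]
    by (simp add: abs_mult)
  then have *: "Infinite_Sum.abs_summable_on (\<lambda>x. pmf p x * f x) UNIV"
  proof (rule Infinite_Sum.abs_summable_on_comparison_test)
    fix x
    have "\<bar>f x\<bar> * pmf p x \<le> \<bar>B\<bar> * pmf p x"
      using assms[of x] by (intro mult_right_mono) auto
    then show "norm (pmf p x * f x) \<le> norm (B * pmf p x)" by (simp add: abs_mult mult_ac)
  qed
  then have "infsum (\<lambda>x. pmf p x * f x) UNIV = measure_pmf.expectation p f"
    unfolding pmf_expectation_eq_infsetsum abs_summable_equivalent by (rule infsetsum_infsum[symmetric])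
  with abs_summable_summable[OF *] show ?thesis by (simp only: has_sum_iff)
qed

lemma convolve_bind: "convolve p q = bind_pmf p (\<lambda>x. map_pmf (\<lambda>y. x + y) q)"
  unfolding convolve_def pair_pmf_def map_pmf_def
  by (simp add: bind_assoc_pmf bind_return_pmf)

lemma pmf_translate: "pmf (map_pmf (\<lambda>y. x + y) q) g = pmf q (- x + g)" for g :: "'a::group_add"
  using pmf_map_inj'[of "\<lambda>y. x + y" q "- x + g"] by (simp add: inj_def add.assoc[symmetric])

lemma has_sum_convolve:
  "((\<lambda>x. pmf p x * pmf q (- x + g)) has_sum pmf (convolve p q) g) UNIV"
proof -
  have "pmf (convolve p q) g = measure_pmf.expectation p (\<lambda>x. pmf q (- x + g))"
    by (simp add: convolve_bind pmf_bind pmf_translate)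
  then show ?thesis
    using has_sum_pmf_expectation[of "\<lambda>x. pmf q (- x + g)" 1 p] by (simp add: pmf_le_1)
qed

lemma symmetric_conv_power:
  assumes "symmetric_pmf \<nu>"
  shows "pmf (conv_power n \<nu>) (- g) = pmf (conv_power n \<nu>) g"
proof (induction n arbitrary: g)
  case 0
  show ?case by (simp add: indicator_def pmf_return)
next
  case (Suc n)
  \<comment> \<open>Reflecting reverses the order of the factors, so the last increment is moved to the front.\<close>
  have "((\<lambda>x. pmf \<nu> x * pmf (conv_power n \<nu>) (- x + g)) has_sum pmf (conv_power (Suc n) \<nu>) g) UNIV"
    using has_sum_convolve[of \<nu> "conv_power n \<nu>" g] conv_power_add[of 1 n \<nu>] by simp
  moreover have "((\<lambda>x. pmf (conv_power n \<nu>) x * pmf \<nu> (- x + - g)) has_sum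
      pmf (conv_power (Suc n) \<nu>) (- g)) UNIV"
    using has_sum_convolve[of "conv_power n \<nu>" \<nu> "- g"] by simp
  moreover have "((\<lambda>x. pmf \<nu> x * pmf (conv_power n \<nu>) (- x + g)) has_sum s) UNIV \<longleftrightarrow>
      ((\<lambda>x. pmf (conv_power n \<nu>) x * pmf \<nu> (- x + - g)) has_sum s) UNIV" for s
  proof (rule has_sum_reindex_bij_witness[where j = "\<lambda>x. - g + x" and i = "\<lambda>x. g + x"])
    fix x
    have "pmf \<nu> (- (- g + x) + - g) = pmf \<nu> x"
      using assms by (simp add: symmetric_pmf_def minus_add add.assoc)
    moreover have "pmf (conv_power n \<nu>) (- g + x) = pmf (conv_power n \<nu>) (- x + g)"
      using Suc.IH[of "- x + g"] by (simp add: minus_add)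
    ultimately show "pmf (conv_power n \<nu>) (- g + x) * pmf \<nu> (- (- g + x) + - g) =
        pmf \<nu> x * pmf (conv_power n \<nu>) (- x + g)" by simp
  qed (auto simp: add.assoc[symmetric])
  ultimately show ?case using has_sum_unique by blast
qed

lemma has_sum_conv_power:
  "((\<lambda>x. pmf (conv_power m \<nu>) x * pmf (conv_power n \<nu>) (- x + g)) has_sum
    pmf (conv_power (m + n) \<nu>) g) UNIV"
  unfolding conv_power_add by (rule has_sum_convolve)

lemma conv_power_partial_sum:
  assumes "finite F"
  shows "(\<Sum>x\<in>F. pmf (conv_power m \<nu>) x * pmf (conv_power n \<nu>) (- x + g))
    \<le> pmf (conv_power (m + n) \<nu>) g"
  by (rule finite_sum_le_has_sum[OF has_sum_conv_power assms]) auto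

text \<open>
  A lazy walk can wait: densities decrease by at most a constant factor in a bounded time. This
  also absorbs parity and remainders in divisions of the time.
\<close>

lemma conv_power_hold:
  "pmf \<nu> 0 ^ k * pmf (conv_power n \<nu>) g \<le> pmf (conv_power (n + k) \<nu>) g"
proof (induction k)
  case (Suc k)
  have "pmf (conv_power (n + k) \<nu>) g * pmf \<nu> 0 \<le> pmf (conv_power (n + Suc k) \<nu>) g"
    using conv_power_partial_sum[of "{g}" "n + k" \<nu> 1 g] by simp
  moreover have "pmf \<nu> 0 * (pmf \<nu> 0 ^ k * pmf (conv_power n \<nu>) g)
      \<le> pmf \<nu> 0 * pmf (conv_power (n + k) \<nu>) g"
    by (intro mult_left_mono Suc) auto
  ultimately show ?case by (simp add: mult_ac)
qed simp

section \<open>Chebyshev polynomials\<close>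

text \<open>
  The Chebyshev polynomials of the first and second kind, generated jointly by the addition
  theorems of cosine and sine at $x = \cos\theta$. The indices are such that the second component
  of \<open>cheb n\<close> is the classical $U_{n-1}$.
\<close>

fun cheb :: "nat \<Rightarrow> real poly \<times> real poly" where
  "cheb 0 = (1, 0)"
| "cheb (Suc n) = (case cheb n of (t, u) \<Rightarrow> ([:0, 1:] * t - (1 - [:0, 1:]\<^sup>2) * u, [:0, 1:] * u + t))"

definition cheb_T :: "nat \<Rightarrow> real poly" where "cheb_T n = fst (cheb n)"
definition cheb_U :: "nat \<Rightarrow> real poly" where "cheb_U n = snd (cheb n)"

lemma cheb_0 [simp]: "cheb_T 0 = 1" "cheb_U 0 = 0"
  by (simp_all add: cheb_T_def cheb_U_def)

lemma cheb_Suc: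
  "cheb_T (Suc n) = [:0, 1:] * cheb_T n - (1 - [:0, 1:]\<^sup>2) * cheb_U n"
  "cheb_U (Suc n) = [:0, 1:] * cheb_U n + cheb_T n"
  by (simp_all add: cheb_T_def cheb_U_def split: prod.split)

text \<open>
  This identity is the algebraic form of $|T_n| \le 1$ on $[-1, 1]$. Evaluated at a self-adjoint
  contraction $A$ it yields $\|T_n(A) f\|^2 = \|f\|^2 - \langle (1 - A^2) U_{n-1}(A) f, U_{n-1}(A) f\rangle
  \le \|f\|^2$ without any spectral theorem.
\<close>

lemma Pell_cheb: "(cheb_T n)\<^sup>2 + (1 - [:0, 1:]\<^sup>2) * (cheb_U n)\<^sup>2 = 1"
proof (induction n)
  case (Suc n)
  have "(x * t - (1 - x\<^sup>2) * u)\<^sup>2 + (1 - x\<^sup>2) * (x * u + t)\<^sup>2 = t\<^sup>2 + (1 - x\<^sup>2) * u\<^sup>2"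
    for x t u :: "real poly"
    by (simp add: power2_eq_square algebra_simps)
  then show ?case using Suc by (simp only: cheb_Suc)
qed simp

lemma poly_cheb_cos:
  "poly (cheb_T n) (cos \<theta>) = cos (real n * \<theta>)"
  "poly (cheb_U n) (cos \<theta>) * sin \<theta> = sin (real n * \<theta>)"
proof (induction n)
  case (Suc n)
  have split: "real (Suc n) * \<theta> = real n * \<theta> + \<theta>" by (simp add: algebra_simps)
  have "poly (cheb_T (Suc n)) (cos \<theta>)
      = cos \<theta> * cos (real n * \<theta>) - sin \<theta> * (poly (cheb_U n) (cos \<theta>) * sin \<theta>)"
    using Suc(1) sin_squared_eq[of \<theta>] by (simp add: cheb_Suc power2_eq_square mult_ac)
  then show "poly (cheb_T (Suc n)) (cos \<theta>) = cos (real (Suc n) * \<theta>)"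
    unfolding Suc(2) split cos_add by (simp add: mult_ac)
  have "poly (cheb_U (Suc n)) (cos \<theta>) * sin \<theta>
      = cos \<theta> * (poly (cheb_U n) (cos \<theta>) * sin \<theta>) + cos (real n * \<theta>) * sin \<theta>"
    using Suc(1) by (simp add: cheb_Suc algebra_simps)
  then show "poly (cheb_U (Suc n)) (cos \<theta>) * sin \<theta> = sin (real (Suc n) * \<theta>)"
    unfolding Suc(2) split sin_add by (simp add: mult_ac)
qed simp_all

lemma degree_cheb: "degree (cheb_T n) \<le> n \<and> (cheb_U n = 0 \<or> degree (cheb_U n) < n)"
proof (induction n)
  case (Suc n)
  have X: "degree ([:0, 1:] * p) \<le> Suc (degree p)" for p :: "real poly"
    using degree_mult_le[of "[:0, 1:]" p] by simp
  have Y: "degree (1 - [:0, 1:]\<^sup>2 :: real poly) \<le> 2"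
    by (intro degree_diff_le) (auto simp: power2_eq_square)
  have "degree ((1 - [:0, 1:]\<^sup>2) * cheb_U n) \<le> Suc n"
  proof (cases "cheb_U n = 0")
    case False
    then show ?thesis
      using Suc degree_mult_le[of "1 - [:0, 1:]\<^sup>2" "cheb_U n"] Y by linarith
  qed simp
  moreover have "degree ([:0, 1:] * cheb_T n) \<le> Suc n" using X[of "cheb_T n"] Suc by linarith
  ultimately have "degree (cheb_T (Suc n)) \<le> Suc n" unfolding cheb_Suc by (rule degree_diff_le[rotated])
  moreover have "degree ([:0, 1:] * cheb_U n) \<le> n"
    using X[of "cheb_U n"] Suc by (cases "cheb_U n = 0") auto
  then have "degree (cheb_U (Suc n)) \<le> n" unfolding cheb_Suc using Suc by (intro degree_add_le) auto
  ultimately show ?case by simp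
qed simp

text \<open>
  The distance from the origin of a simple random walk on the integers which has made \<open>k\<close> of its
  \<open>N\<close> steps to the right. The probability of this event is \<open>Bernstein N k (1/2)\<close>.
\<close>

definition coin_dist :: "nat \<Rightarrow> nat \<Rightarrow> nat" where
  "coin_dist N k = nat \<bar>2 * int k - int N\<bar>"

text \<open>
  The binomial expansion of $2^{-N} (e^{i\theta} + e^{-i\theta})^N$.
\<close>

lemma cos_power_expansion:
  "cos \<theta> ^ N = (\<Sum>k\<le>N. Bernstein N k (1/2) * cos (real (coin_dist N k) * \<theta>))"
proof -
  have "(2 * complex_of_real (cos \<theta>)) ^ N = (cis \<theta> + cis (- \<theta>)) ^ N"
    by (simp add: complex_eq_iff cis.ctr)
  also have "\<dots> = (\<Sum>k\<le>N. of_nat (N choose k) * cis \<theta> ^ k * cis (- \<theta>) ^ (N - k))"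
    by (rule binomial_ring)
  also have "\<dots> = (\<Sum>k\<le>N. complex_of_real (real (N choose k)) * cis ((2 * real k - real N) * \<theta>))"
  proof (rule sum.cong)
    fix k assume "k \<in> {..N}"
    then have "real k * \<theta> + real (N - k) * - \<theta> = (2 * real k - real N) * \<theta>"
      by (simp add: of_nat_diff algebra_simps)
    then have "cis \<theta> ^ k * cis (- \<theta>) ^ (N - k) = cis ((2 * real k - real N) * \<theta>)"
      by (simp only: Complex.DeMoivre cis_mult)
    then show "of_nat (N choose k) * cis \<theta> ^ k * cis (- \<theta>) ^ (N - k)
        = complex_of_real (real (N choose k)) * cis ((2 * real k - real N) * \<theta>)"
      by (simp add: mult.assoc)
  qed simp
  finally have "Re ((2 * complex_of_real (cos \<theta>)) ^ N)
      = (\<Sum>k\<le>N. real (N choose k) * cos ((2 * real k - real N) * \<theta>))"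
    by (simp add: Re_sum)
  then have "(2 * cos \<theta>) ^ N = (\<Sum>k\<le>N. real (N choose k) * cos ((2 * real k - real N) * \<theta>))"
    by (metis Re_complex_of_real of_real_mult of_real_numeral of_real_power)
  moreover have "cos ((2 * real k - real N) * \<theta>) = cos (real (coin_dist N k) * \<theta>)" for k
  proof (cases "2 * k \<ge> N")
    case True
    then have "real (coin_dist N k) = 2 * real k - real N" by (simp add: coin_dist_def)
    then show ?thesis by simp
  next
    case False
    then have "real (coin_dist N k) = - (2 * real k - real N)" by (simp add: coin_dist_def)
    then show ?thesis by (metis cos_minus mult_minus_left)
  qed
  ultimately have "(2 * cos \<theta>) ^ N = (\<Sum>k\<le>N. real (N choose k) * cos (real (coin_dist N k) * \<theta>))"
    by simp
  also have "\<dots> = (\<Sum>k\<le>N. 2 ^ N * (Bernstein N k (1/2) * cos (real (coin_dist N k) * \<theta>)))"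
    by (intro sum.cong) (auto simp: Bernstein_def power_diff field_simps power_add[symmetric])
  finally show ?thesis
    by (simp add: power_mult_distrib sum_distrib_left[symmetric])
qed

text \<open>
  Both polynomials agree at all cosines, hence on the infinite set $[-1, 1]$.
\<close>

lemma monom_cheb_expansion:
  "monom 1 N = (\<Sum>k\<le>N. smult (Bernstein N k (1/2)) (cheb_T (coin_dist N k)))" (is "?l = ?r")
proof (rule ccontr)
  assume "?l \<noteq> ?r"
  then have "finite {x. poly (?l - ?r) x = 0}" by (intro poly_roots_finite) simp
  moreover have "{-1..1} \<subseteq> {x. poly (?l - ?r) x = 0}"
  proof safe
    fix x :: real assume x: "x \<in> {-1..1}"
    have "poly ?l (cos (arccos x)) = poly ?r (cos (arccos x))"
      by (simp add: poly_monom poly_sum poly_cheb_cos cos_power_expansion)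
    then show "poly (?l - ?r) x = 0" using x by (simp add: cos_arccos)
  qed
  ultimately have "finite {-1..1::real}" by (rule rev_finite_subset)
  then show False using infinite_Icc[of "-1::real" 1] by simp
qed

text \<open>
  The variance of the simple random walk after \<open>N\<close> steps is \<open>N\<close>, so this is the inequality of
  Bienayme and Chebyshev.
\<close>

lemma binomial_tail:
  assumes "d > 0"
  shows "(\<Sum>k\<in>{k. k \<le> N \<and> d < coin_dist N k}. Bernstein N k (1/2)) \<le> real N / (real d)\<^sup>2"
proof -
  have sq: "(real (coin_dist N k))\<^sup>2 = (2 * real k - real N)\<^sup>2" for k
  proof -
    have "real (coin_dist N k) = \<bar>2 * real k - real N\<bar>" by (simp add: coin_dist_def nat_abs_int_diff) 
    then show ?thesis by simp
  qed
  have "(\<Sum>k\<le>N. (real (coin_dist N k))\<^sup>2 * Bernstein N k (1/2))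
      = (\<Sum>k\<le>N. 4 * (real k * (real k - 1) * Bernstein N k (1/2))
          + (4 - 4 * real N) * (real k * Bernstein N k (1/2)) + (real N)\<^sup>2 * Bernstein N k (1/2))"
    unfolding sq by (intro sum.cong) (auto simp: power2_eq_square algebra_simps)
  also have "\<dots> = 4 * (real N * (real N - 1) * (1/2)\<^sup>2) + (4 - 4 * real N) * (real N * (1/2)) + (real N)\<^sup>2"
    by (simp only: sum.distrib sum_distrib_left[symmetric] sum_kk_Bernstein sum_k_Bernstein sum_Bernstein mult_1_right)
  also have "\<dots> = real N" by (simp add: power2_eq_square field_simps)
  finally have var: "(\<Sum>k\<le>N. (real (coin_dist N k))\<^sup>2 * Bernstein N k (1/2)) = real N" .
  have "(real d)\<^sup>2 * (\<Sum>k\<in>{k. k \<le> N \<and> d < coin_dist N k}. Bernstein N k (1/2))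
      \<le> (\<Sum>k\<in>{k. k \<le> N \<and> d < coin_dist N k}. (real (coin_dist N k))\<^sup>2 * Bernstein N k (1/2))"
    unfolding sum_distrib_left
    by (intro sum_mono mult_right_mono power_mono) (auto simp: Bernstein_nonneg)
  also have "\<dots> \<le> (\<Sum>k\<le>N. (real (coin_dist N k))\<^sup>2 * Bernstein N k (1/2))"
    by (intro sum_mono2) (auto simp: Bernstein_nonneg)
  finally show ?thesis using assms unfolding var by (simp add: field_simps)
qed

section \<open>Moment functionals and time extrapolation\<close>

text \<open>
  When $h(k) = \langle A^k f, f'\rangle$ for an operator $A$, \<open>moment h c\<close> is
  $\langle c(A) f, f'\rangle$. Working with the numbers $h(k)$, here densities at times in
  arithmetic progression, makes polynomial functional calculus available without the space
  $\ell^2$.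
\<close>

definition moment :: "(nat \<Rightarrow> real) \<Rightarrow> real poly \<Rightarrow> real" where
  "moment h c = (\<Sum>k\<le>degree c. coeff c k * h k)"

lemma moment_degree_le: "degree c \<le> n \<Longrightarrow> moment h c = (\<Sum>k\<le>n. coeff c k * h k)"
  unfolding moment_def by (rule sum.mono_neutral_left) (auto intro: coeff_eq_0)

lemma moment_0 [simp]: "moment h 0 = 0"
  by (simp add: moment_def)

lemma moment_1 [simp]: "moment h 1 = h 0"
  by (simp add: moment_def)

lemma moment_monom: "moment h (monom 1 N) = h N"
  using moment_degree_le[of "monom 1 N" N h]
  by (simp add: degree_monom_le if_distrib[of "\<lambda>c. c * _"] cong: if_cong)

lemma moment_add: "moment h (a + b) = moment h a + moment h b"
proof -
  define n where "n = max (degree a) (degree b)"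
  have "degree (a + b) \<le> n" "degree a \<le> n" "degree b \<le> n"
    by (auto simp: n_def intro: degree_add_le_max)
  then show ?thesis by (simp add: moment_degree_le sum.distrib[symmetric] algebra_simps)
qed

lemma moment_smult: "moment h (smult r a) = r * moment h a"
  using moment_degree_le[of "smult r a" "degree a" h]
  by (simp add: moment_def sum_distrib_left mult.assoc degree_smult_le)

lemma moment_diff: "moment h (a - b) = moment h a - moment h b"
  using moment_add[of h "a - b" b] by simp

lemma moment_sum: "moment h (sum a K) = (\<Sum>k\<in>K. moment h (a k))"
  by (induction K rule: infinite_finite_induct) (simp_all add: moment_add)

lemma moment_pCons: "moment h (pCons r a) = r * h 0 + moment (\<lambda>k. h (Suc k)) a"
  using moment_degree_le[of "pCons r a" "Suc (degree a)" h]
  by (simp add: moment_def degree_pCons_le sum.atMost_Suc_shift del: sum.atMost_Suc)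

text \<open>
  The Gram matrix of the vectors $A^i f$ is a Hankel matrix: a product of polynomials may be
  distributed over the two sides of the inner product.
\<close>

lemma moment_mult: "moment h (a * b) = moment (\<lambda>i. moment (\<lambda>j. h (i + j)) b) a"
proof (induction a arbitrary: h)
  case (pCons r a)
  then show ?case
    by (simp add: mult_pCons_left moment_add moment_smult moment_pCons)
qed simp

lemma moment_X: "moment h ([:0, 1:] * c) = moment (\<lambda>k. h (Suc k)) c"
  by (simp add: moment_pCons)

lemma moment_cmult: "moment (\<lambda>k. r * h k) c = r * moment h c"
  by (simp add: moment_def sum_distrib_left mult_ac)

lemma has_sum_moment:
  assumes "\<And>k. ((\<lambda>x. f x k) has_sum h k) A"
  shows "((\<lambda>x. moment (f x) c) has_sum moment h c) A"
proof -
  have "((\<lambda>x. \<Sum>k\<le>n. coeff c k * f x k) has_sum (\<Sum>k\<le>n. coeff c k * h k)) A" for n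
    by (induction n) (auto intro!: has_sum_add has_sum_cmult_right assms)
  then show ?thesis by (simp add: moment_def)
qed

locale symmetric_walk =
  fixes \<nu> :: "'a::group_add pmf"
  assumes symmetric: "symmetric_pmf \<nu>"
begin

abbreviation p :: "nat \<Rightarrow> 'a \<Rightarrow> real" where
  "p n g \<equiv> pmf (conv_power n \<nu>) g"

lemma p_minus: "p n (- g) = p n g"
  by (rule symmetric_conv_power[OF symmetric])

lemma has_sum_p: "((\<lambda>x. p m x * p n (- x + g)) has_sum p (m + n) g) UNIV"
  by (rule has_sum_conv_power)

text \<open>
  The function $c(A) p_n$, where $A$ is convolution by $p_s$.
\<close>

definition wave :: "nat \<Rightarrow> nat \<Rightarrow> real poly \<Rightarrow> 'a \<Rightarrow> real" where
  "wave n s c x = moment (\<lambda>i. p (n + s * i) x) c"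

lemma wave_minus: "wave n s c (- x) = wave n s c x"
  by (simp add: wave_def p_minus)

lemma has_sum_wave:
  "((\<lambda>x. wave n s a x * wave n s b (- x + z)) has_sum moment (\<lambda>k. p (2 * n + s * k) z) (a * b)) UNIV"
proof -
  have "((\<lambda>x. p (n + s * i) x * p (n + s * j) (- x + z)) has_sum p (2 * n + s * (i + j)) z) UNIV" for i j
  proof -
    have "n + s * i + (n + s * j) = 2 * n + s * (i + j)" by (simp add: algebra_simps)
    then show ?thesis using has_sum_p[of "n + s * i" "n + s * j" z] by (simp only:)
  qed
  then have "((\<lambda>x. moment (\<lambda>j. p (n + s * i) x * p (n + s * j) (- x + z)) b) has_sum
      moment (\<lambda>j. p (2 * n + s * (i + j)) z) b) UNIV" for i
    by (rule has_sum_moment)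
  then have "((\<lambda>x. moment (\<lambda>i. moment (\<lambda>j. p (n + s * i) x * p (n + s * j) (- x + z)) b) a) has_sum
      moment (\<lambda>i. moment (\<lambda>j. p (2 * n + s * (i + j)) z) b) a) UNIV"
    by (rule has_sum_moment)
  moreover have "moment (\<lambda>i. moment (\<lambda>j. p (n + s * i) x * p (n + s * j) (- x + z)) b) a
      = wave n s a x * wave n s b (- x + z)" for x
    using moment_cmult[of "wave n s b (- x + z)" "\<lambda>i. p (n + s * i) x" a]
    by (simp add: wave_def moment_cmult mult.commute)
  ultimately show ?thesis by (simp only: moment_mult)
qed

lemma has_sum_wave_square:
  "((\<lambda>x. (wave n s a x)\<^sup>2) has_sum moment (\<lambda>k. p (2 * n + s * k) 0) (a * a)) UNIV"
  using has_sum_wave[of n s a a 0] by (simp add: wave_minus power2_eq_square)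

text \<open>
  The inequality $2 |\langle F, G\rangle| \le \|F\|^2 + \|G\|^2$ for $F = a(A) p_n$ and a translate
  $G$ of the reflection of $b(A) p_n$, which has the norm of $b(A) p_n$.
\<close>

lemma abs_moment_mult_le:
  "2 * \<bar>moment (\<lambda>k. p (2 * n + s * k) z) (a * b)\<bar>
    \<le> moment (\<lambda>k. p (2 * n + s * k) 0) (a * a) + moment (\<lambda>k. p (2 * n + s * k) 0) (b * b)"
proof -
  have "((\<lambda>x. (wave n s b (- x + z))\<^sup>2) has_sum moment (\<lambda>k. p (2 * n + s * k) 0) (b * b)) UNIV
      \<longleftrightarrow> ((\<lambda>x. (wave n s b x)\<^sup>2) has_sum moment (\<lambda>k. p (2 * n + s * k) 0) (b * b)) UNIV"
    by (rule has_sum_reindex_bij_witness[where j = "\<lambda>x. - x + z" and i = "\<lambda>x. z - x"])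
       (auto simp: minus_diff_eq minus_add diff_conv_add_uminus add.assoc simp del: add_uminus_conv_diff)
  then have b: "((\<lambda>x. (wave n s b (- x + z))\<^sup>2) has_sum moment (\<lambda>k. p (2 * n + s * k) 0) (b * b)) UNIV"
    using has_sum_wave_square by blast
  have sum: "((\<lambda>x. (wave n s a x)\<^sup>2 + (wave n s b (- x + z))\<^sup>2 + \<sigma> * (wave n s a x * wave n s b (- x + z)))
      has_sum moment (\<lambda>k. p (2 * n + s * k) 0) (a * a) + moment (\<lambda>k. p (2 * n + s * k) 0) (b * b)
        + \<sigma> * moment (\<lambda>k. p (2 * n + s * k) z) (a * b)) UNIV" for \<sigma>
    by (intro has_sum_add has_sum_cmult_right has_sum_wave_square b has_sum_wave)
  have "0 \<le> moment (\<lambda>k. p (2 * n + s * k) 0) (a * a) + moment (\<lambda>k. p (2 * n + s * k) 0) (b * b)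
        + \<sigma> * moment (\<lambda>k. p (2 * n + s * k) z) (a * b)" if "\<sigma> = 2 \<or> \<sigma> = - 2" for \<sigma>
  proof (rule has_sum_nonneg[OF sum])
    fix x
    have "0 \<le> (wave n s a x + \<sigma> / 2 * wave n s b (- x + z))\<^sup>2" by simp
    then show "0 \<le> (wave n s a x)\<^sup>2 + (wave n s b (- x + z))\<^sup>2 + \<sigma> * (wave n s a x * wave n s b (- x + z))"
      using that by (auto simp: power2_eq_square algebra_simps)
  qed
  from this[of 2] this[of "- 2"] show ?thesis by simp
qed

lemma moment_square_nonneg: "0 \<le> moment (\<lambda>k. p (2 * n + s * k) 0) (a * a)"
  by (rule has_sum_nonneg[OF has_sum_wave_square]) simp

lemma p_even_le: "p (2 * n) g \<le> p (2 * n) 0"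
  using abs_moment_mult_le[of n 0 g 1 1] by simp

text \<open>
  $\|A F\| \le \|F\|$. Indeed $\|A F\|^2$ is the average under $p_{2s}$ of inner products of $F$
  with its translates, each of which is at most $\|F\|^2$.
\<close>

lemma moment_contraction:
  "moment (\<lambda>k. p (2 * n + s * k) 0) ([:0, 1:]\<^sup>2 * (a * a)) \<le> moment (\<lambda>k. p (2 * n + s * k) 0) (a * a)"
proof (rule has_sum_mono)
  have "((\<lambda>y. p (2 * s) y * p (2 * n + s * k) (- y + 0)) has_sum p (2 * n + s * Suc (Suc k)) 0) UNIV" for k
    using has_sum_p[of "2 * s" "2 * n + s * k" 0] by (simp add: algebra_simps)
  then have "((\<lambda>y. moment (\<lambda>k. p (2 * s) y * p (2 * n + s * k) (- y + 0)) (a * a)) has_sum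
      moment (\<lambda>k. p (2 * n + s * Suc (Suc k)) 0) (a * a)) UNIV"
    by (rule has_sum_moment)
  moreover have "moment (\<lambda>k. p (2 * n + s * k) 0) ([:0, 1:]\<^sup>2 * (a * a))
      = moment (\<lambda>k. p (2 * n + s * Suc (Suc k)) 0) (a * a)"
    unfolding power2_eq_square mult.assoc[of "[:0, 1:]" "[:0, 1:]"] moment_X by simp
  ultimately show "((\<lambda>y. p (2 * s) y * moment (\<lambda>k. p (2 * n + s * k) (- y)) (a * a)) has_sum
      moment (\<lambda>k. p (2 * n + s * k) 0) ([:0, 1:]\<^sup>2 * (a * a))) UNIV"
    by (simp add: moment_cmult)
  show "((\<lambda>y. p (2 * s) y * moment (\<lambda>k. p (2 * n + s * k) 0) (a * a)) has_sum
      moment (\<lambda>k. p (2 * n + s * k) 0) (a * a)) UNIV"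
    using has_sum_cmult_left[OF has_sum_pmf, of "conv_power (2 * s) \<nu>"] by fastforce
  show "p (2 * s) y * moment (\<lambda>k. p (2 * n + s * k) (- y)) (a * a)
      \<le> p (2 * s) y * moment (\<lambda>k. p (2 * n + s * k) 0) (a * a)" for y
    using abs_moment_mult_le[of n s "- y" a a] by (intro mult_left_mono) auto
qed

text \<open>
  Pell's equation together with the contraction property bounds $\|T_j(A) p_n\|$ by $\|p_n\|$.
\<close>

lemma abs_moment_cheb_le: "\<bar>moment (\<lambda>k. p (2 * n + s * k) z) (cheb_T j)\<bar> \<le> p (2 * n) 0"
proof -
  let ?h = "\<lambda>k. p (2 * n + s * k) 0"
  have "moment ?h (cheb_T j * cheb_T j)
      = moment ?h 1 - (moment ?h (cheb_U j * cheb_U j) - moment ?h ([:0, 1:]\<^sup>2 * (cheb_U j * cheb_U j)))"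
  proof -
    have "cheb_T j * cheb_T j = 1 - (cheb_U j * cheb_U j - [:0, 1:]\<^sup>2 * (cheb_U j * cheb_U j))"
      using Pell_cheb[of j] unfolding power2_eq_square by (simp only: algebra_simps)
    then show ?thesis by (simp only: moment_diff)
  qed
  then have "moment ?h (cheb_T j * cheb_T j) \<le> p (2 * n) 0"
    using moment_contraction[of n s "cheb_U j"] by simp
  then show ?thesis using abs_moment_mult_le[of n s z "cheb_T j" 1] by simp
qed

text \<open>
  Smallness of the densities at the times $2n + si$, $i \le d$, propagates to the later time
  $2n + sN$. In the Chebyshev expansion of $A^N$ the terms with index at most $d$ are combinations
  of the early densities, with coefficients depending on $d$ only; the other terms have total
  weight at most $N / d^2$ and each is bounded by $p_{2n}(0)$.
\<close>

lemma time_extrapolation: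
  assumes "d > 0"
  obtains \<Gamma> where "\<Gamma> > 0"
    and "\<And>n s N g. p (2 * n + s * N) g
      \<le> \<Gamma> * (\<Sum>i\<le>d. p (2 * n + s * i) g) + real N / (real d)\<^sup>2 * p (2 * n) 0"
proof
  define \<Gamma> where "\<Gamma> = 1 + (\<Sum>j\<le>d. \<Sum>i\<le>d. \<bar>coeff (cheb_T j) i\<bar>)"
  show "\<Gamma> > 0" unfolding \<Gamma>_def by (smt (verit) sum_nonneg abs_ge_zero)
  show "p (2 * n + s * N) g
      \<le> \<Gamma> * (\<Sum>i\<le>d. p (2 * n + s * i) g) + real N / (real d)\<^sup>2 * p (2 * n) 0" for n s N g
  proof -
    define S where "S = (\<Sum>i\<le>d. p (2 * n + s * i) g)"
    let ?h = "\<lambda>k. p (2 * n + s * k) g"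
    let ?w = "\<lambda>k. Bernstein N k (1/2)"
    have w: "0 \<le> ?w k" for k by (simp add: Bernstein_nonneg)
    have low: "moment ?h (cheb_T j) \<le> \<Gamma> * S" if "j \<le> d" for j
    proof -
      have "moment ?h (cheb_T j) = (\<Sum>i\<le>d. coeff (cheb_T j) i * ?h i)"
        using degree_cheb[of j] that by (intro moment_degree_le) simp
      also have "\<dots> \<le> (\<Sum>i\<le>d. \<Gamma> * ?h i)"
      proof (intro sum_mono mult_right_mono)
        fix i assume "i \<in> {..d}"
        then have "\<bar>coeff (cheb_T j) i\<bar> \<le> (\<Sum>i\<le>d. \<bar>coeff (cheb_T j) i\<bar>)"
          by (intro member_le_sum) auto
        also have "\<dots> \<le> (\<Sum>j\<le>d. \<Sum>i\<le>d. \<bar>coeff (cheb_T j) i\<bar>)"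
          using that by (intro member_le_sum[of j "{..d}" "\<lambda>j. \<Sum>i\<le>d. \<bar>coeff (cheb_T j) i\<bar>"])
            (auto intro: sum_nonneg)
        finally show "coeff (cheb_T j) i \<le> \<Gamma>" by (simp add: \<Gamma>_def)
      qed simp
      finally show ?thesis by (simp add: S_def sum_distrib_left)
    qed
    have S: "0 \<le> S" unfolding S_def by (intro sum_nonneg) simp
    have split: "{..N} = {k. k \<le> N \<and> coin_dist N k \<le> d} \<union> {k. k \<le> N \<and> d < coin_dist N k}" by auto
    have "p (2 * n + s * N) g = (\<Sum>k\<le>N. ?w k * moment ?h (cheb_T (coin_dist N k)))"
      using moment_monom[of ?h N] monom_cheb_expansion[of N] by (simp add: moment_sum moment_smult)
    also have "\<dots> = (\<Sum>k\<in>{k. k \<le> N \<and> coin_dist N k \<le> d}. ?w k * moment ?h (cheb_T (coin_dist N k)))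
        + (\<Sum>k\<in>{k. k \<le> N \<and> d < coin_dist N k}. ?w k * moment ?h (cheb_T (coin_dist N k)))"
      unfolding split by (rule sum.union_disjoint) auto
    also have "\<dots> \<le> (\<Sum>k\<in>{k. k \<le> N \<and> coin_dist N k \<le> d}. ?w k * (\<Gamma> * S))
        + (\<Sum>k\<in>{k. k \<le> N \<and> d < coin_dist N k}. ?w k * p (2 * n) 0)"
      using abs_moment_cheb_le[of n s g] low
      by (intro add_mono sum_mono mult_left_mono w) (auto simp: abs_le_iff)
    also have "\<dots> \<le> (\<Sum>k\<le>N. ?w k) * (\<Gamma> * S)
        + (\<Sum>k\<in>{k. k \<le> N \<and> d < coin_dist N k}. ?w k) * p (2 * n) 0"
      unfolding sum_distrib_right[symmetric] using S \<open>\<Gamma> > 0\<close> w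
      by (intro add_mono mult_right_mono sum_mono2) auto
    also have "\<dots> \<le> \<Gamma> * S + real N / (real d)\<^sup>2 * p (2 * n) 0"
      using binomial_tail[OF assms, of N] by (intro add_mono mult_right_mono) auto
    finally show ?thesis by (simp add: S_def)
  qed
qed

end

section \<open>The regularity given by the pseudo-Poincare inequality\<close>

lemma nonneg_has_sum_SigmaI:
  fixes f :: "'b \<times> 'c \<Rightarrow> real"
  assumes "\<And>x. x \<in> A \<Longrightarrow> ((\<lambda>y. f (x, y)) has_sum g x) (B x)" and "(g has_sum S) A"
    and "\<And>z. z \<in> Sigma A B \<Longrightarrow> 0 \<le> f z"
  shows "(f has_sum S) (Sigma A B)"
proof (rule has_sum_SigmaI[OF assms(1,2)])
  show "f summable_on Sigma A B"
    using assms by (intro summable_on_SigmaI[of _ _ _ g]) (auto dest: has_sum_imp_summable)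
qed

context symmetric_walk
begin

lemma has_sum_increments: "((\<lambda>y. pmf \<nu> (- x + y)) has_sum 1) UNIV"
proof -
  have "((\<lambda>y. pmf \<nu> (- x + y)) has_sum 1) UNIV \<longleftrightarrow> (pmf \<nu> has_sum 1) UNIV"
    by (rule has_sum_reindex_bij_witness[where j = "\<lambda>y. - x + y" and i = "\<lambda>y. x + y"])
       (auto simp: add.assoc[symmetric])
  then show ?thesis using has_sum_pmf by blast
qed

lemma increment_swap: "pmf \<nu> (- x + y) = pmf \<nu> (- y + x)"
  using symmetric by (metis symmetric_pmf_def minus_add minus_minus)

text \<open>
  Expanding the square and summing out one variable: each row of $\nu(-x + y)$ has sum 1.
\<close>

lemma dirichlet_form_finite:
  fixes f :: "'a \<Rightarrow> real"
  assumes "finite F" and supp: "\<And>x. x \<notin> F \<Longrightarrow> f x = 0"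
  shows "dirichlet_form \<nu> f
    = (\<Sum>x\<in>F. (f x)\<^sup>2) - (\<Sum>(x, y)\<in>F \<times> F. f x * f y * pmf \<nu> (- x + y))"
proof -
  have sq: "((\<lambda>x. (f x)\<^sup>2) has_sum (\<Sum>x\<in>F. (f x)\<^sup>2)) UNIV"
    using assms by (intro has_sum_finite_neutralI[of F]) auto
  have left: "((\<lambda>(x, y). (f x)\<^sup>2 * pmf \<nu> (- x + y)) has_sum (\<Sum>x\<in>F. (f x)\<^sup>2)) (UNIV \<times> UNIV)"
    using has_sum_cmult_right[OF has_sum_increments]
    by (intro nonneg_has_sum_SigmaI[OF _ sq]) fastforce+
  then have right: "((\<lambda>(x, y). (f y)\<^sup>2 * pmf \<nu> (- x + y)) has_sum (\<Sum>x\<in>F. (f x)\<^sup>2)) (UNIV \<times> UNIV)"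
  proof (subst has_sum_swap)
    have "(\<lambda>(x, y). (\<lambda>(x, y). (f y)\<^sup>2 * pmf \<nu> (- x + y)) (y, x)) = (\<lambda>(x, y). (f x)\<^sup>2 * pmf \<nu> (- x + y))"
      unfolding fun_eq_iff split_paired_All case_prod_conv using increment_swap by metis
    with left show "((\<lambda>(x, y). (\<lambda>(x, y). (f y)\<^sup>2 * pmf \<nu> (- x + y)) (y, x)) has_sum
        (\<Sum>x\<in>F. (f x)\<^sup>2)) (UNIV \<times> UNIV)" by simp
  qed
  have cross: "((\<lambda>(x, y). f x * f y * pmf \<nu> (- x + y)) has_sum
      (\<Sum>(x, y)\<in>F \<times> F. f x * f y * pmf \<nu> (- x + y))) (UNIV \<times> UNIV)"
    using assms(1) contrapos_nn[OF _ supp]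
    by (intro has_sum_finite_neutralI[of "F \<times> F"]) (auto, blast+)
  have "((\<lambda>z. (\<lambda>(x, y). (f x)\<^sup>2 * pmf \<nu> (- x + y)) z + (\<lambda>(x, y). (f y)\<^sup>2 * pmf \<nu> (- x + y)) z
      + (- 2) * (\<lambda>(x, y). f x * f y * pmf \<nu> (- x + y)) z) has_sum
      (\<Sum>x\<in>F. (f x)\<^sup>2) + (\<Sum>x\<in>F. (f x)\<^sup>2)
      + (- 2) * (\<Sum>(x, y)\<in>F \<times> F. f x * f y * pmf \<nu> (- x + y))) (UNIV \<times> UNIV)"
    by (intro has_sum_add has_sum_cmult_right left right cross)
  moreover have "(\<lambda>z. (\<lambda>(x, y). (f x)\<^sup>2 * pmf \<nu> (- x + y)) z + (\<lambda>(x, y). (f y)\<^sup>2 * pmf \<nu> (- x + y)) z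
      + (- 2) * (\<lambda>(x, y). f x * f y * pmf \<nu> (- x + y)) z)
      = (\<lambda>(x, y). (f x - f y)\<^sup>2 * pmf \<nu> (- x + y))"
    by (auto simp: fun_eq_iff power2_eq_square algebra_simps)
  ultimately show ?thesis unfolding dirichlet_form_def by (simp add: infsumI)
qed

text \<open>
  The off-diagonal part of $\mathcal E_\nu(p_n, p_n)$.
\<close>

lemma has_sum_energy_cross:
  "((\<lambda>(x, y). p n x * p n y * pmf \<nu> (- x + y)) has_sum p (2 * n + 1) 0) (UNIV \<times> UNIV)"
proof (rule nonneg_has_sum_SigmaI)
  show "((\<lambda>y. (\<lambda>(x, y). p n x * p n y * pmf \<nu> (- x + y)) (x, y)) has_sum p n x * p (n + 1) x) UNIV" for x
    using has_sum_cmult_right[OF has_sum_p[of n 1 x], of "p n x"]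
    by (simp add: increment_swap[of x] mult.assoc)
  show "((\<lambda>x. p n x * p (n + 1) x) has_sum p (2 * n + 1) 0) UNIV"
    using has_sum_p[of n "n + 1" 0] by (simp add: p_minus mult_2 del: conv_power.simps)
qed auto

lemma has_sum_square_increments:
  "((\<lambda>x. (p n (x + g) - p n x)\<^sup>2) has_sum 2 * (p (2 * n) 0 - p (2 * n) g)) UNIV"
proof -
  have sq: "((\<lambda>x. (p n x)\<^sup>2) has_sum p (2 * n) 0) UNIV"
    using has_sum_p[of n n 0] by (simp add: p_minus mult_2 power2_eq_square)
  have "((\<lambda>x. (p n (x + g))\<^sup>2) has_sum p (2 * n) 0) UNIV \<longleftrightarrow> ((\<lambda>x. (p n x)\<^sup>2) has_sum p (2 * n) 0) UNIV"
    by (rule has_sum_reindex_bij_witness[where j = "\<lambda>x. x + g" and i = "\<lambda>x. x + - g"])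
       (simp_all add: add.assoc)
  with sq have sq_shift: "((\<lambda>x. (p n (x + g))\<^sup>2) has_sum p (2 * n) 0) UNIV" by blast
  have "((\<lambda>x. p n x * p n (x + g)) has_sum p (2 * n) g) UNIV
      \<longleftrightarrow> ((\<lambda>x. p n x * p n (- x + g)) has_sum p (2 * n) g) UNIV"
    by (rule has_sum_reindex_bij_witness[where j = uminus and i = uminus]) (simp_all add: p_minus)
  then have cross: "((\<lambda>x. p n x * p n (x + g)) has_sum p (2 * n) g) UNIV"
    using has_sum_p[of n n g] by (simp add: mult_2)
  have "((\<lambda>x. (p n (x + g))\<^sup>2 + (p n x)\<^sup>2 + (- 2) * (p n x * p n (x + g))) has_sum
      p (2 * n) 0 + p (2 * n) 0 + (- 2) * p (2 * n) g) UNIV"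
    by (intro has_sum_add has_sum_cmult_right sq sq_shift cross)
  then show ?thesis by (simp add: power2_eq_square algebra_simps)
qed

text \<open>
  The pseudo-Poincare inequality is assumed for finitely supported functions, and $p_n$ need not
  be one. It is applied to truncations of $p_n$ to finite sets $F$. As $p_n \ge 0$, the energy of a
  truncation is at most $p_{2n}(0)$ minus any finite part of the cross term supported in
  $F \times F$, so that enlarging $F$ gives the inequality in the limit.
\<close>

lemma pseudo_poincare_conv_power:
  fixes K :: real
  assumes pp: "\<And>f :: 'a \<Rightarrow> real. finite {x. f x \<noteq> 0} \<Longrightarrow>
      (\<Sum>\<^sub>\<infinity>x\<in>UNIV. \<bar>f (x + g) - f x\<bar>\<^sup>2) \<le> K * dirichlet_form \<nu> f"
    and K: "K \<ge> 0"
  shows "2 * (p (2 * n) 0 - p (2 * n) g) \<le> K * (p (2 * n) 0 - p (2 * n + 1) 0)"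
proof (rule has_sum_le_finite_sums[OF has_sum_square_increments])
  fix H :: "'a set" assume H: "finite H" "H \<subseteq> UNIV"
  let ?D = "\<Sum>x\<in>H. (p n (x + g) - p n x)\<^sup>2"
  have "K * p (2 * n + 1) 0 \<le> K * p (2 * n) 0 - ?D"
  proof (rule has_sum_le_finite_sums[OF has_sum_cmult_right[OF has_sum_energy_cross]])
    fix P :: "('a \<times> 'a) set" assume P: "finite P" "P \<subseteq> UNIV \<times> UNIV"
    define F where "F = H \<union> (\<lambda>x. x + g) ` H \<union> fst ` P \<union> snd ` P"
    define f where "f x = (if x \<in> F then p n x else 0)" for x
    have F: "finite F" using H P by (simp add: F_def)
    have supp: "{x. f x \<noteq> 0} \<subseteq> F" by (auto simp: f_def)
    have "?D = (\<Sum>x\<in>H. \<bar>f (x + g) - f x\<bar>\<^sup>2)"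
      by (intro sum.cong) (auto simp: f_def F_def)
    also have "\<dots> \<le> (\<Sum>\<^sub>\<infinity>x\<in>UNIV. \<bar>f (x + g) - f x\<bar>\<^sup>2)"
    proof (rule finite_sum_le_infsum)
      have "{x. \<bar>f (x + g) - f x\<bar>\<^sup>2 \<noteq> 0} \<subseteq> F \<union> (\<lambda>x. x + - g) ` F"
      proof safe
        fix x assume "\<bar>f (x + g) - f x\<bar>\<^sup>2 \<noteq> 0" "x \<notin> (\<lambda>x. x + - g) ` F"
        moreover have "x = (x + g) + - g" by (simp add: add.assoc)
        ultimately show "x \<in> F" by (metis (mono_tags) diff_self f_def imageI abs_zero zero_power2)
      qed
      then have "finite {x. \<bar>f (x + g) - f x\<bar>\<^sup>2 \<noteq> 0}" using F by (simp add: finite_subset)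
      then show "(\<lambda>x. \<bar>f (x + g) - f x\<bar>\<^sup>2) summable_on UNIV"
        by (intro has_sum_imp_summable[OF has_sum_finite_neutralI[OF _ _ _ refl]]) auto
    qed (use H in auto)
    also have "\<dots> \<le> K * dirichlet_form \<nu> f" using supp F by (intro pp) (rule finite_subset)
    also have "dirichlet_form \<nu> f
        = (\<Sum>x\<in>F. (p n x)\<^sup>2) - (\<Sum>(x, y)\<in>F \<times> F. p n x * p n y * pmf \<nu> (- x + y))"
      by (subst dirichlet_form_finite[OF F]) (auto simp: f_def intro!: sum.cong)
    also have "K * \<dots> \<le> K * (p (2 * n) 0 - (\<Sum>(x, y)\<in>P. p n x * p n y * pmf \<nu> (- x + y)))"
    proof (intro mult_left_mono diff_mono K)
      show "(\<Sum>x\<in>F. (p n x)\<^sup>2) \<le> p (2 * n) 0"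
        using conv_power_partial_sum[OF F, of n \<nu> n 0] by (simp add: p_minus mult_2 power2_eq_square)
      show "(\<Sum>(x, y)\<in>P. p n x * p n y * pmf \<nu> (- x + y))
          \<le> (\<Sum>(x, y)\<in>F \<times> F. p n x * p n y * pmf \<nu> (- x + y))"
        using F by (intro sum_mono2) (force simp: F_def)+
    qed
    finally show "(\<Sum>z\<in>P. K * (case z of (x, y) \<Rightarrow> p n x * p n y * pmf \<nu> (- x + y)))
        \<le> K * p (2 * n) 0 - ?D"
      by (simp add: sum_distrib_left[symmetric] right_diff_distrib)
  qed
  then show "?D \<le> K * (p (2 * n) 0 - p (2 * n + 1) 0)" by (simp add: right_diff_distrib)
qed

text \<open>
  The two sides are the averages of $p_{2n}(0) - p_{2n}(y) \ge 0$ with the weights $\nu(0) \nu(y)$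
  and $\nu^{(2)}(y)$, and laziness orders these weights.
\<close>

lemma lazy_energy_le:
  assumes "pmf \<nu> 0 > 0"
  shows "pmf \<nu> 0 * (p (2 * n) 0 - p (2 * n + 1) 0) \<le> p (2 * n) 0 - p (2 * n + 2) 0"
proof (rule has_sum_mono)
  have *: "((\<lambda>y. p k y * (p (2 * n) 0 - p (2 * n) y)) has_sum p (2 * n) 0 - p (2 * n + k) 0) UNIV" for k
  proof -
    have "((\<lambda>y. p k y * p (2 * n) 0 + - (p k y * p (2 * n) (- y + 0))) has_sum
        1 * p (2 * n) 0 + - p (k + 2 * n) 0) UNIV"
      by (intro has_sum_add has_sum_uminusI has_sum_cmult_left has_sum_pmf has_sum_p)
    then show ?thesis by (simp add: p_minus algebra_simps)
  qed
  show "((\<lambda>y. pmf \<nu> 0 * (pmf \<nu> y * (p (2 * n) 0 - p (2 * n) y))) has_sum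
      pmf \<nu> 0 * (p (2 * n) 0 - p (2 * n + 1) 0)) UNIV"
    using has_sum_cmult_right[OF *[of 1], of "pmf \<nu> 0"] by simp
  show "((\<lambda>y. p 2 y * (p (2 * n) 0 - p (2 * n) y)) has_sum p (2 * n) 0 - p (2 * n + 2) 0) UNIV"
    by (rule *)
  fix y
  have "pmf \<nu> 0 * pmf \<nu> y \<le> p 2 y"
    using conv_power_hold[of \<nu> 1 1 y] by (simp add: numeral_2_eq_2 del: conv_power.simps(2)) 
  then have "pmf \<nu> 0 * pmf \<nu> y * (p (2 * n) 0 - p (2 * n) y) \<le> p 2 y * (p (2 * n) 0 - p (2 * n) y)"
    using p_even_le[of n y] by (intro mult_right_mono) auto
  then show "pmf \<nu> 0 * (pmf \<nu> y * (p (2 * n) 0 - p (2 * n) y)) \<le> p 2 y * (p (2 * n) 0 - p (2 * n) y)"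
    by (simp add: mult.assoc)
qed

text \<open>
  The second difference is $\|p_n - p_{n+2}\|^2$.
\<close>

lemma p_even_convex: "p (2 * n + 2) 0 - p (2 * n + 4) 0 \<le> p (2 * n) 0 - p (2 * n + 2) 0"
proof -
  have "0 \<le> moment (\<lambda>k. p (2 * n + 1 * k) 0) ([:1, 0, -1:] * [:1, 0, -1:])"
    by (rule moment_square_nonneg)
  then show ?thesis by (simp add: moment_pCons numeral_eq_Suc del: conv_power.simps)
qed

text \<open>
  By convexity the decrements of $k \mapsto p_{2k}(0)$ decrease. Since they telescope over
  $[m, n]$ with $m$ about $n / 2$, the last one is at most $2 / n$ times $p_{2m}(0)$.
\<close>

lemma p_even_decrement_le:
  assumes "n \<ge> 1"
  obtains m where "n \<le> 2 * m" and "m \<ge> 1" and "real n * (p (2 * n) 0 - p (2 * n + 2) 0) \<le> 2 * p (2 * m) 0"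
proof
  define D where "D k = p (2 * k) 0 - p (2 * k + 2) 0" for k
  \<comment> \<open>Rounding up keeps $m \ge 1$ for $n = 1$.\<close>
  define m where "m = (n + 1) div 2"
  show "n \<le> 2 * m" "m \<ge> 1" using assms by (auto simp: m_def)
  have "m \<le> n" using assms by (auto simp: m_def)
  have "decseq D"
  proof (rule decseq_SucI)
    fix k
    have "2 * Suc k = 2 * k + 2" "2 * Suc k + 2 = 2 * k + 4" by simp_all
    then show "D (Suc k) \<le> D k" using p_even_convex[of k] by (simp only: D_def)
  qed
  then have "real (card {m..n}) * D n \<le> (\<Sum>k=m..n. D k)"
    by (intro sum_bounded_below) (auto simp: decseq_def)
  also have "\<dots> = p (2 * m) 0 - p (2 * Suc n) 0"
    using sum_telescope''[of m n "\<lambda>k. p (2 * k) 0"] sum_Suc_diff[of m "n" "\<lambda>k. - p (2 * k) 0"] \<open>m \<le> n\<close>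
    by (simp add: D_def del: conv_power.simps)
  also have "\<dots> \<le> p (2 * m) 0" by simp
  finally have "real (card {m..n}) * D n \<le> p (2 * m) 0" .
  moreover have "D n \<ge> 0"
  proof -
    have "p (2 * (n + 1)) 0 \<le> p (2 * n) 0"
    proof -
      have "((\<lambda>y. p 2 y * p (2 * n) (- y + 0)) has_sum p (2 * (n + 1)) 0) UNIV"
        using has_sum_p[of 2 "2 * n" 0] by (simp add: add.commute del: conv_power.simps)
      moreover have "((\<lambda>y. p 2 y * p (2 * n) 0) has_sum p (2 * n) 0) UNIV"
        using has_sum_cmult_left[OF has_sum_pmf, of "conv_power 2 \<nu>"] by fastforce
      ultimately show ?thesis
        by (rule has_sum_mono) (auto intro!: mult_left_mono p_even_le)
    qed
    then show ?thesis by (simp add: D_def algebra_simps del: conv_power.simps)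
  qed
  moreover have "real n \<le> 2 * real (card {m..n})" using assms by (simp add: m_def)
  ultimately have "real n * D n \<le> 2 * p (2 * m) 0"
    using mult_right_mono[of "real n" "2 * real (card {m..n})" "D n"] by linarith
  then show "real n * (p (2 * n) 0 - p (2 * n + 2) 0) \<le> 2 * p (2 * m) 0" by (simp add: D_def)
qed

end

section \<open>Walks on a group with a doubling norm\<close>

locale normed_walk = symmetric_walk \<nu> for \<nu> :: "'a::group_add pmf" +
  fixes nm :: "'a \<Rightarrow> real" and r :: "real \<Rightarrow> real"
  assumes norm: "group_norm nm"
    and volume_doubling: "doubling (volume_fun nm)"
    and scale: "scale_function r"
    and scale_doubling: "doubling r"
    and lazy: "pmf \<nu> 0 > 0"
    and on_diagonal: "comparable_on {1::nat..} (\<lambda>n. p (2 * n) 0)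
       (\<lambda>n. inverse (volume_fun nm (r (real n))))"
begin

abbreviation V :: "real \<Rightarrow> real" where "V \<equiv> volume_fun nm"

definition W :: "real \<Rightarrow> real" where "W t = V (r t)"

definition nball :: "real \<Rightarrow> 'a set" where "nball t = {g. nm g \<le> t}"

lemma nm_0 [simp]: "nm 0 = 0" and nm_add: "nm (g + h) \<le> nm g + nm h"
  using norm by (auto simp: group_norm_def)

lemma V_pos: "t > 0 \<Longrightarrow> V t > 0"
  using volume_doubling by (auto simp: doubling_def)

lemma V_card: "V t = real (card (nball t))"
  by (simp add: volume_fun_def nball_def)

lemma finite_nball: "t > 0 \<Longrightarrow> finite (nball t)"
  using V_pos[of t] by (auto simp: V_card card_gt_0_iff)

lemma V_mono: "0 < s \<Longrightarrow> s \<le> t \<Longrightarrow> V s \<le> V t"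
  unfolding V_card of_nat_le_iff by (rule card_mono[OF finite_nball]) (auto simp: nball_def)

lemma r_pos: "t > 0 \<Longrightarrow> r t > 0"
  using scale_doubling by (auto simp: doubling_def)

lemma r_mono: "0 < s \<Longrightarrow> s \<le> t \<Longrightarrow> r s \<le> r t"
  using scale unfolding scale_function_def
  by (metis greaterThan_iff less_le_trans order_le_less strict_mono_onD)

lemma r_less: "0 < s \<Longrightarrow> s < t \<Longrightarrow> r s < r t"
  using scale unfolding scale_function_def
  by (metis greaterThan_iff less_trans strict_mono_onD)

lemma V_dilation:
  assumes "a > 0"
  obtains C where "C \<ge> 1" and "\<And>t. t > 0 \<Longrightarrow> V (a * t) \<le> C * V t"
  using doubling_mono_dilation[OF volume_doubling V_mono assms] by blast

lemma r_dilation: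
  assumes "a > 0"
  obtains C where "C \<ge> 1" and "\<And>t. t > 0 \<Longrightarrow> r (a * t) \<le> C * r t"
  using doubling_mono_dilation[OF scale_doubling r_mono assms] by blast

lemma W_pos: "t > 0 \<Longrightarrow> W t > 0"
  by (simp add: W_def V_pos r_pos)

lemma W_mono: "0 < s \<Longrightarrow> s \<le> t \<Longrightarrow> W s \<le> W t"
  by (simp add: W_def V_mono r_pos r_mono)

lemma W_dilation:
  assumes "a > 0"
  obtains C where "C \<ge> 1" and "\<And>t. t > 0 \<Longrightarrow> W (a * t) \<le> C * W t"
proof -
  obtain A where A: "A \<ge> 1" "\<And>t. t > 0 \<Longrightarrow> r (a * t) \<le> A * r t" using r_dilation[OF assms] by blast
  obtain C where C: "C \<ge> 1" "\<And>t. t > 0 \<Longrightarrow> V (A * t) \<le> C * V t"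
    using V_dilation[of A] A(1) by auto
  show ?thesis
  proof (rule that[OF C(1)])
    fix t :: real assume t: "t > 0"
    have "V (r (a * t)) \<le> V (A * r t)" using t assms A(2) by (intro V_mono r_pos) auto
    also have "\<dots> \<le> C * V (r t)" using t by (intro C r_pos)
    finally show "W (a * t) \<le> C * W t" by (simp add: W_def)
  qed
qed

lemma scale_unbounded: obtains n0 :: nat where "n0 \<ge> 1" and "\<And>n. n \<ge> n0 \<Longrightarrow> b \<le> r (real n)"
proof -
  have "max b 1 \<in> r ` {0<..}" using scale by (auto simp: scale_function_def bij_betw_def)
  then obtain t where t: "t > 0" "r t = max b 1" by auto
  show ?thesis
  proof (rule that[of "nat \<lceil>t\<rceil>"])
    show "nat \<lceil>t\<rceil> \<ge> 1" using t(1) by linarith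
    fix n assume "n \<ge> nat \<lceil>t\<rceil>"
    then have "t \<le> real n" by linarith
    then show "b \<le> r (real n)" using r_mono[OF t(1)] t(2) by fastforce
  qed
qed

lemma inverse_scale_pos_eq:
  assumes "s > 0"
  shows "inverse_scale r s > 0" and "r (inverse_scale r s) = s"
proof -
  have "s \<in> r ` {0<..}" using scale assms by (auto simp: scale_function_def bij_betw_def)
  then show "inverse_scale r s > 0" and "r (inverse_scale r s) = s"
    using inv_into_into[of s r "{0<..}"] f_inv_into_f[of s r "{0<..}"] assms
    by (auto simp: inverse_scale_def)
qed

lemma inverse_scale_nonneg: "inverse_scale r s \<ge> 0"
  using inverse_scale_pos_eq(1)[of s] by (cases "s > 0") (auto simp: inverse_scale_def)

lemma inverse_scale_le:
  assumes "s \<le> r t" and "t > 0"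
  shows "inverse_scale r s \<le> t"
proof (cases "s > 0")
  case True
  then show ?thesis
    using assms inverse_scale_pos_eq[of s] r_less[of t "inverse_scale r s"] by linarith
qed (use assms in \<open>auto simp: inverse_scale_def\<close>)

lemma on_diagonal_bounds:
  obtains c C where "c > 0" and "C > 0"
    and "\<And>n. n \<ge> 1 \<Longrightarrow> c / W (real n) \<le> p (2 * n) 0"
    and "\<And>n. n \<ge> 1 \<Longrightarrow> p (2 * n) 0 \<le> C / W (real n)"
proof -
  obtain c C where "0 < c" "c \<le> C" and
    "\<forall>n\<in>{1::nat..}. c * inverse (V (r (real n))) \<le> p (2 * n) 0 \<and> p (2 * n) 0 \<le> C * inverse (V (r (real n)))"
    using on_diagonal unfolding comparable_on_def by blast
  then show ?thesis by (intro that[of c C]) (auto simp: W_def divide_inverse)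
qed

text \<open>
  Combining the pseudo-Poincare inequality with the decay of the energy gives
  $p_{2n}(0) - p_{2n}(g) \le A \rho(\|g\|) / (n W(n))$. The radius $\delta r(n)$ is chosen, by
  doubling of $r$, such that $\rho(\|g\|) \le \epsilon n$ makes this half of the on-diagonal lower
  bound.
\<close>

lemma near_diagonal:
  assumes "pseudo_poincare nm r \<nu>"
  obtains \<delta> c where "\<delta> > 0" and "c > 0"
    and "\<And>n g. n \<ge> 1 \<Longrightarrow> nm g \<le> \<delta> * r (real n) \<Longrightarrow> c / W (real n) \<le> p (2 * n) g"
proof -
  obtain C1 where C1: "\<And>f :: 'a \<Rightarrow> real. \<And>g. finite {x. f x \<noteq> 0} \<Longrightarrow>
      (\<Sum>\<^sub>\<infinity>x\<in>UNIV. \<bar>f (x + g) - f x\<bar>\<^sup>2) \<le> C1 * inverse_scale r (nm g) * dirichlet_form \<nu> f"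
    using assms unfolding pseudo_poincare_def by blast
  \<comment> \<open>$C_1$ may be negative, while the estimates below are multiplied by the constant.\<close>
  define C where "C = max C1 0"
  have pp: "(\<Sum>\<^sub>\<infinity>x\<in>UNIV. \<bar>f (x + g) - f x\<bar>\<^sup>2) \<le> C * inverse_scale r (nm g) * dirichlet_form \<nu> f"
    if "finite {x. f x \<noteq> 0}" for f :: "'a \<Rightarrow> real" and g
  proof -
    have "0 \<le> dirichlet_form \<nu> f" by (auto simp: dirichlet_form_def intro!: infsum_nonneg)
    then have "C1 * inverse_scale r (nm g) * dirichlet_form \<nu> f
        \<le> C * inverse_scale r (nm g) * dirichlet_form \<nu> f"
      by (intro mult_right_mono inverse_scale_nonneg) (auto simp: C_def)
    with C1[OF that, of g] show ?thesis by linarith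
  qed
  obtain c0 C0 where c0: "c0 > 0" "\<And>n. n \<ge> 1 \<Longrightarrow> c0 / W (real n) \<le> p (2 * n) 0"
    and C0: "C0 > 0" "\<And>n. n \<ge> 1 \<Longrightarrow> p (2 * n) 0 \<le> C0 / W (real n)"
    using on_diagonal_bounds by metis
  obtain CW where CW: "CW \<ge> 1" "\<And>t. t > 0 \<Longrightarrow> W (2 * t) \<le> CW * W t"
    using W_dilation[of 2] by auto
  define A where "A = C * C0 * CW / pmf \<nu> 0"
  have A: "A \<ge> 0" using C0 CW by (simp add: A_def C_def)
  define \<epsilon> where "\<epsilon> = c0 / (2 * (A + 1))"
  have \<epsilon>: "\<epsilon> > 0" using c0 A by (simp add: \<epsilon>_def)
  obtain Cr where Cr: "Cr \<ge> 1" "\<And>t. t > 0 \<Longrightarrow> r (1 / \<epsilon> * t) \<le> Cr * r t"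
    using r_dilation[of "1 / \<epsilon>"] \<epsilon> by auto
  show ?thesis
  proof (rule that[of "1 / Cr" "c0 / 2"])
    show "1 / Cr > 0" using Cr by simp
    show "c0 / 2 > 0" using c0 by simp
    fix n :: nat and g assume n: "n \<ge> 1" and g: "nm g \<le> 1 / Cr * r (real n)"
    define \<rho> where "\<rho> = inverse_scale r (nm g)"
    have Wn: "W (real n) > 0" using n by (simp add: W_pos)
    have "r (real n) \<le> Cr * r (\<epsilon> * real n)" using Cr(2)[of "\<epsilon> * real n"] \<epsilon> n by simp
    then have "1 / Cr * r (real n) \<le> r (\<epsilon> * real n)" using Cr(1) by (simp add: field_simps)
    with g have "nm g \<le> r (\<epsilon> * real n)" by linarith
    then have \<rho>: "0 \<le> \<rho>" "\<rho> \<le> \<epsilon> * real n"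
      unfolding \<rho>_def using \<epsilon> n by (auto intro!: inverse_scale_le inverse_scale_nonneg)
    obtain m where m: "n \<le> 2 * m" "m \<ge> 1"
      and dec: "real n * (p (2 * n) 0 - p (2 * n + 2) 0) \<le> 2 * p (2 * m) 0"
      using p_even_decrement_le[OF n] by blast
    have "W (real n) \<le> CW * W (real m)"
      using W_mono[of "real n" "2 * real m"] CW(2)[of "real m"] n m by simp
    then have Wm: "1 / W (real m) \<le> CW / W (real n)" using Wn m by (simp add: field_simps W_pos)
    have "real n * (p (2 * n) 0 - p (2 * n + 2) 0) \<le> 2 * (C0 * (1 / W (real m)))"
      using dec C0(2)[OF m(2)] by simp
    also have "\<dots> \<le> 2 * (C0 * (CW / W (real n)))"
      using Wm C0(1) by (intro mult_left_mono) auto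
    finally have "p (2 * n) 0 - p (2 * n + 2) 0 \<le> 2 * (C0 * CW / W (real n)) / real n"
      using n by (intro mult_imp_le_div_pos) (simp_all add: mult.commute[of _ "real n"] del: conv_power.simps)
    then have energy: "pmf \<nu> 0 * (p (2 * n) 0 - p (2 * n + 1) 0) \<le> 2 * (C0 * CW / W (real n)) / real n"
      using lazy_energy_le[OF lazy, of n] by linarith
    have "2 * (p (2 * n) 0 - p (2 * n) g) \<le> C * \<rho> * (p (2 * n) 0 - p (2 * n + 1) 0)"
      unfolding \<rho>_def by (rule pseudo_poincare_conv_power[OF pp])
        (auto simp: C_def inverse_scale_nonneg)
    also have "\<dots> \<le> C * \<rho> * (2 * (C0 * CW / W (real n)) / real n / pmf \<nu> 0)"
      using energy \<rho>
      by (intro mult_left_mono mult_imp_le_div_pos[OF lazy])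
        (simp_all only: mult.commute[of _ "pmf \<nu> 0"] C_def, simp)
    also have "\<dots> = 2 * (A * (\<rho> / real n) / W (real n))" by (simp add: A_def field_simps)
    also have "\<dots> \<le> 2 * (c0 / 2 / W (real n))"
    proof -
      have "A * (\<rho> / real n) \<le> A * \<epsilon>" using \<rho> A n by (intro mult_left_mono) (auto simp: field_simps)
      also have "\<dots> \<le> (A + 1) * \<epsilon>" using \<epsilon> by (intro mult_right_mono) auto
      also have "\<dots> = c0 / 2" using A by (simp add: \<epsilon>_def field_simps)
      finally show ?thesis using Wn by (intro mult_left_mono divide_right_mono) auto
    qed
    finally have "p (2 * n) 0 - p (2 * n) g \<le> c0 / 2 / W (real n)" by simp
    moreover have "c0 / W (real n) \<le> p (2 * n) 0" by (rule c0(2)[OF n])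
    moreover have "c0 / W (real n) = c0 / 2 / W (real n) + c0 / 2 / W (real n)" by simp
    ultimately show "c0 / 2 / W (real n) \<le> p (2 * n) g" by linarith
  qed
qed

section \<open>Chaining\<close>

lemma conv_lower_bound:
  assumes "finite B" and "inj_on \<phi> B"
    and "\<And>w. w \<in> B \<Longrightarrow> q \<le> p m (\<phi> w)" and "\<And>w. w \<in> B \<Longrightarrow> q' \<le> p k (- \<phi> w + g)"
    and "q \<ge> 0" and "q' \<ge> 0"
  shows "real (card B) * (q * q') \<le> p (m + k) g"
proof -
  have "real (card B) * (q * q') \<le> (\<Sum>w\<in>B. p m (\<phi> w) * p k (- \<phi> w + g))"
    using assms by (intro sum_bounded_below mult_mono) auto
  also have "\<dots> = (\<Sum>x\<in>\<phi> ` B. p m x * p k (- x + g))" using assms(2) by (simp add: sum.reindex)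
  also have "\<dots> \<le> p (m + k) g" using assms(1) by (intro conv_power_partial_sum) simp
  finally show ?thesis .
qed

text \<open>
  Restricting a convolution to as many intermediate points as there are in a ball: if the volume
  of the ball is comparable to \<open>W t\<close>, then two lower bounds of order \<open>1 / W t\<close> yield another one.
\<close>

lemma ball_conv_lower_bound:
  assumes R: "R > 0" and vol: "\<theta> * W t \<le> V R" and t: "t > 0" and "\<theta> \<ge> 0" "c \<ge> 0" "c' \<ge> 0"
    and "inj_on \<phi> (nball R)"
    and "\<And>w. w \<in> nball R \<Longrightarrow> c / W t \<le> p m (\<phi> w)"
    and "\<And>w. w \<in> nball R \<Longrightarrow> c' / W t \<le> p k (- \<phi> w + g)"
  shows "\<theta> * c * c' / W t \<le> p (m + k) g"
proof -
  have W: "W t > 0" using t by (rule W_pos)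
  have "\<theta> * c * c' / W t = \<theta> * W t * (c / W t * (c' / W t))" using W by (simp add: field_simps)
  also have "\<dots> \<le> V R * (c / W t * (c' / W t))" using vol W assms by (intro mult_right_mono) auto
  also have "\<dots> \<le> p (m + k) g"
    unfolding V_card using assms W by (intro conv_lower_bound[OF finite_nball]) auto
  finally show ?thesis .
qed

text \<open>
  A small norm of $a$ says nothing about $-a$. The walk therefore goes to $-a + e$ through the
  points $-(w + a)$ with $w$ in a ball: the first half has density $p_m(w + a)$ by symmetry of
  $p_m$, the second one $p_m(w + e)$, and both arguments are short.
\<close>

lemma difference_lower_bound:
  assumes "R > 0" and "\<theta> * W t \<le> V R" and "t > 0" and "\<theta> \<ge> 0" "c \<ge> 0"
    and "\<And>w. w \<in> nball R \<Longrightarrow> c / W t \<le> p m (w + a) \<and> c / W t \<le> p m (w + e)"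
  shows "\<theta> * c * c / W t \<le> p (m + m) (- a + e)"
proof (rule ball_conv_lower_bound[OF assms(1-5) assms(5), where \<phi> = "\<lambda>w. - (w + a)"])
  show "inj_on (\<lambda>w. - (w + a)) (nball R)" by (rule inj_onI) simp
qed (use assms(6) in \<open>auto simp: p_minus add.assoc[symmetric] simp del: minus_add\<close>)

text \<open>
  The translates of the ball of radius \<open>R\<close> to \<open>x\<close> and to \<open>y\<close> meet. This relation is symmetric even
  if the norm is not.
\<close>

definition touching :: "real \<Rightarrow> 'a \<Rightarrow> 'a \<Rightarrow> bool" where
  "touching R x y \<longleftrightarrow> (\<exists>h\<in>nball R. \<exists>h'\<in>nball R. x + h = y + h')"

lemma touching_refl: "R \<ge> 0 \<Longrightarrow> touching R x x"
  unfolding touching_def nball_def by (intro bexI[of _ 0]) auto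

text \<open>
  If $x + h = y + h'$, then $-k - x + y + k' = (-k + (h + u)) + (-(h' + u) + k')$ for every $u$ in
  the ball, and both summands are differences of short elements.
\<close>

lemma touching_lower_bound:
  assumes R: "R > 0" and vol: "\<theta> * W (real n) \<le> V R" and n: "n \<ge> 1" and "\<theta> \<ge> 0" "c \<ge> 0"
    and near: "\<And>g. nm g \<le> 3 * R \<Longrightarrow> c / W (real n) \<le> p (2 * n) g"
    and "touching R x y" "k \<in> nball R" "k' \<in> nball R"
  shows "\<theta> * (\<theta> * c * c) * (\<theta> * c * c) / W (real n) \<le> p (8 * n) (- k + - x + y + k')"
proof -
  have two: "\<theta> * c * c / W (real n) \<le> p (4 * n) (- a + e)" if "nm a \<le> 2 * R" "nm e \<le> 2 * R" for a e
  proof -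
    have "nm (w + a) \<le> 3 * R \<and> nm (w + e) \<le> 3 * R" if "w \<in> nball R" for w
      using nm_add[of w a] nm_add[of w e] that \<open>nm a \<le> 2 * R\<close> \<open>nm e \<le> 2 * R\<close>
      by (simp add: nball_def)
    then have "\<theta> * c * c / W (real n) \<le> p (2 * n + 2 * n) (- a + e)"
      using assms near by (intro difference_lower_bound[of R]) auto
    then show ?thesis by simp
  qed
  obtain h h' where h: "h \<in> nball R" "h' \<in> nball R" "x + h = y + h'"
    using assms(7) unfolding touching_def by blast
  have xy: "- x + y = h + - h'"
  proof -
    have "x + (h + - h') = (x + h) + - h'" by (simp only: add.assoc)
    also have "\<dots> = y" by (simp only: h(3) add.assoc right_minus add_0_right)
    finally have "x + (h + - h') = y" .
    then show ?thesis by (metis add.assoc add_0 left_minus)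
  qed
  have "\<theta> * (\<theta> * c * c) * (\<theta> * c * c) / W (real n) \<le> p (4 * n + 4 * n) (- k + - x + y + k')"
  proof (rule ball_conv_lower_bound[OF R vol, where \<phi> = "\<lambda>u. - k + (h + u)"])
    show "inj_on (\<lambda>u. - k + (h + u)) (nball R)" by (rule inj_onI) simp
    fix u assume u: "u \<in> nball R"
    show "\<theta> * c * c / W (real n) \<le> p (4 * n) (- k + (h + u))"
      using u h assms R nm_add[of h u] by (intro two) (auto simp: nball_def)
    have "- (- k + (h + u)) + (- k + - x + y + k') = - (h + u) + (k + - k) + (- x + y) + k'"
      by (simp only: minus_add minus_minus add.assoc)
    also have "\<dots> = - u + - h + (h + - h') + k'"
      by (simp only: right_minus add_0_right xy minus_add)
    also have "\<dots> = - (h' + u) + k'"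
      by (simp only: minus_add add.assoc minus_add_cancel)
    finally have *: "- (- k + (h + u)) + (- k + - x + y + k') = - (h' + u) + k'" .
    show "\<theta> * c * c / W (real n) \<le> p (4 * n) (- (- k + (h + u)) + (- k + - x + y + k'))"
      unfolding * using u h assms R nm_add[of h' u] by (intro two) (auto simp: nball_def)
  qed (use assms in auto)
  then show ?thesis by simp
qed

lemma chain_lower_bound:
  assumes R: "R > 0" and vol: "\<theta> * W (real n) \<le> V R" and n: "n \<ge> 1" and "\<theta> \<ge> 0" "c \<ge> 0"
    and step: "\<And>x y k k'. touching R x y \<Longrightarrow> k \<in> nball R \<Longrightarrow> k' \<in> nball R \<Longrightarrow>
        c / W (real n) \<le> p (8 * n) (- k + - x + y + k')"
    and "ys 0 = 0" and "\<And>i. i < N \<Longrightarrow> touching R (ys i) (ys (Suc i))"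
    and "i \<le> N" and "k \<in> nball R"
  shows "c * (\<theta> * c) ^ i / W (real n) \<le> p (8 * n * Suc i) (ys i + k)"
  using \<open>i \<le> N\<close> \<open>k \<in> nball R\<close>
proof (induction i arbitrary: k)
  case 0
  then show ?case
    using step[of 0 0 0 k] R assms(7) by (simp add: touching_refl nball_def)
next
  case (Suc i)
  have "\<theta> * (c * (\<theta> * c) ^ i) * c / W (real n) \<le> p (8 * n * Suc i + 8 * n) (ys (Suc i) + k)"
  proof (rule ball_conv_lower_bound[OF R vol, where \<phi> = "\<lambda>u. ys i + u"])
    show "inj_on ((+) (ys i)) (nball R)" by (rule inj_onI) simp
    fix u assume u: "u \<in> nball R"
    show "c * (\<theta> * c) ^ i / W (real n) \<le> p (8 * n * Suc i) (ys i + u)"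
      using Suc u by simp
    have "- (ys i + u) + (ys (Suc i) + k) = - u + - ys i + ys (Suc i) + k"
      by (simp only: minus_add add.assoc)
    then show "c / W (real n) \<le> p (8 * n) (- (ys i + u) + (ys (Suc i) + k))"
      using step[of "ys i" "ys (Suc i)" u k] u Suc.prems assms(8)[of i] by simp
  qed (use assms in auto)
  moreover have "8 * n * Suc i + 8 * n = 8 * n * Suc (Suc i)" by simp
  ultimately show ?case by (simp only: power_Suc mult_ac)
qed

text \<open>
  In a chain of minimal length, points which are not consecutive do not touch, since otherwise
  the chain could be shortened. Its points of even index thus form a packing, which bounds the
  length. The final point is repeated to give all chains the same length.
\<close>

lemma short_chain:
  assumes "finite S" and "xs 0 = x" "xs N = y" "\<And>i. i \<le> N \<Longrightarrow> xs i \<in> S"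
    and "\<And>i. i < N \<Longrightarrow> touching R (xs i) (xs (Suc i))"
    and packing: "\<And>Z. Z \<subseteq> S \<Longrightarrow> pairwise (\<lambda>x y. \<not> touching R x y) Z \<Longrightarrow> card Z \<le> M" and R: "R \<ge> 0"
  obtains ys where "ys 0 = x" "ys (2 * M) = y" "\<And>i. i < 2 * M \<Longrightarrow> touching R (ys i) (ys (Suc i))"
proof -
  define chain where "chain m ys \<longleftrightarrow> ys 0 = x \<and> ys m = y \<and> (\<forall>i\<le>m. ys i \<in> S) \<and>
      (\<forall>i<m. touching R (ys i) (ys (Suc i)))" for m :: nat and ys
  define m where "m = (LEAST m. \<exists>ys. chain m ys)"
  have "\<exists>ys. chain N ys" using assms by (auto simp: chain_def)
  then have "\<exists>ys. chain m ys" unfolding m_def by (rule LeastI)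
  then obtain ys where ys: "chain m ys" by blast
  have shortest: "\<not> touching R (ys i) (ys j)" if ij: "Suc i < j" "j \<le> m" for i j
  proof
    assume t: "touching R (ys i) (ys j)"
    define zs where "zs k = (if k \<le> i then ys k else ys (k + (j - Suc i)))" for k
    have "chain (m - (j - Suc i)) zs"
      unfolding chain_def
    proof (intro conjI allI impI)
      show "zs 0 = x" using ys by (simp add: zs_def chain_def)
      have "\<not> m - (j - Suc i) \<le> i" "m - (j - Suc i) + (j - Suc i) = m" using ij by simp_all
      then show "zs (m - (j - Suc i)) = y" using ys by (simp only: zs_def chain_def if_False)
      fix k
      show "zs k \<in> S" if "k \<le> m - (j - Suc i)" using that ys ij by (simp add: zs_def chain_def)
      show "touching R (zs k) (zs (Suc k))" if k: "k < m - (j - Suc i)"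
      proof (cases k i rule: linorder_cases)
        case less
        then show ?thesis using ys ij by (simp add: zs_def chain_def)
      next
        case equal
        then show ?thesis using t ij by (simp add: zs_def)
      next
        case greater
        then show ?thesis using ys ij k by (simp add: zs_def chain_def)
      qed
    qed
    then have "m \<le> m - (j - Suc i)" unfolding m_def by (metis Least_le)
    then show False using ij by simp
  qed
  have sym: "touching R a b \<longleftrightarrow> touching R b a" for a b by (metis touching_def)
  have far: "\<not> touching R (ys (2 * i)) (ys (2 * j))" if "i \<noteq> j" "i \<le> m div 2" "j \<le> m div 2" for i j
  proof (cases "i < j")
    case True
    then show ?thesis using that by (intro shortest) auto
  next
    case False
    then show ?thesis using that by (subst sym, intro shortest) auto
  qed
  have inj: "inj_on (\<lambda>i. ys (2 * i)) {..m div 2}"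
  proof (rule inj_onI)
    fix i j assume ij: "i \<in> {..m div 2}" "j \<in> {..m div 2}" "ys (2 * i) = ys (2 * j)"
    then have "touching R (ys (2 * i)) (ys (2 * j))" using touching_refl[OF R] by simp
    then show "i = j" using far[of i j] ij by auto
  qed
  have "card ((\<lambda>i. ys (2 * i)) ` {..m div 2}) \<le> M"
  proof (rule packing)
    show "(\<lambda>i. ys (2 * i)) ` {..m div 2} \<subseteq> S" using ys by (auto simp: chain_def)
    show "pairwise (\<lambda>x y. \<not> touching R x y) ((\<lambda>i. ys (2 * i)) ` {..m div 2})"
      unfolding pairwise_image using far by (auto simp: pairwise_def)
  qed
  then have "m \<le> 2 * M" by (simp add: card_image[OF inj])
  show ?thesis
  proof (rule that[of "\<lambda>i. ys (min i m)"])
    show "ys (min 0 m) = x" "ys (min (2 * M) m) = y" using ys \<open>m \<le> 2 * M\<close> by (auto simp: chain_def)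
    show "touching R (ys (min i m)) (ys (min (Suc i) m))" for i
      using ys touching_refl[OF R] by (cases "i < m") (auto simp: chain_def min_def)
  qed
qed

text \<open>
  The translates of a ball to the points of \<open>Z\<close> are disjoint and lie in a larger ball.
\<close>

lemma packing_bound:
  assumes R: "R > 0" and T: "T > 0" and vol: "V (T + R) \<le> real M * V R"
    and Z: "Z \<subseteq> nball T" "pairwise (\<lambda>x y. \<not> touching R x y) Z"
  shows "card Z \<le> M"
proof -
  have fin: "finite Z" using Z(1) finite_nball[OF T] finite_subset by blast
  have "card (\<Union>z\<in>Z. (\<lambda>h. z + h) ` nball R) = (\<Sum>z\<in>Z. card ((\<lambda>h. z + h) ` nball R))"
  proof (rule card_UN_disjoint[OF fin])
    show "\<forall>i\<in>Z. \<forall>j\<in>Z. i \<noteq> j \<longrightarrow> (\<lambda>h. i + h) ` nball R \<inter> (\<lambda>h. j + h) ` nball R = {}"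
      using Z(2) unfolding pairwise_def touching_def by blast
  qed (simp add: finite_nball R)
  also have "\<dots> = card Z * card (nball R)" by (simp add: card_image inj_on_def)
  finally have "real (card Z) * V R = real (card (\<Union>z\<in>Z. (\<lambda>h. z + h) ` nball R))" by (simp add: V_card)
  also have "\<dots> \<le> V (T + R)"
    unfolding V_card of_nat_le_iff
  proof (rule card_mono)
    show "(\<Union>z\<in>Z. (\<lambda>h. z + h) ` nball R) \<subseteq> nball (T + R)"
    proof safe
      fix z h assume "z \<in> Z" "h \<in> nball R"
      then show "z + h \<in> nball (T + R)"
        using Z(1) nm_add[of z h] by (auto simp: nball_def)
    qed
  qed (use R T finite_nball in simp)
  also note vol
  finally show ?thesis using V_pos[OF R] by simp
qed

text \<open>
  Once $\delta r(n)$ exceeds the step bound of the well-connected norm, the connecting sequence of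
  $g$ becomes a chain of touching balls of radius $\delta r(n) / 3$, which can be replaced by one
  of the length $2M$ where $M$ depends on $\kappa$ but not on $n$.
\<close>

lemma chaining:
  assumes wc: "well_connected nm" and "\<delta> > 0" "c > 0" "\<kappa> > 0"
    and near: "\<And>n g. n \<ge> 1 \<Longrightarrow> nm g \<le> \<delta> * r (real n) \<Longrightarrow> c / W (real n) \<le> p (2 * n) g"
  obtains L n1 c' where "L \<ge> 1" "n1 \<ge> 1" "c' > 0"
    and "\<And>n g. n \<ge> n1 \<Longrightarrow> nm g \<le> \<kappa> * r (real n) \<Longrightarrow> c' / W (real n) \<le> p (2 * n * L) g"
proof -
  obtain b where b: "b > 0" "\<And>t x. t > 0 \<Longrightarrow> nm x \<le> t \<Longrightarrow> \<exists>(N::nat) xs. xs 0 = 0 \<and> xs N = x \<and>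
      (\<forall>i\<le>N. nm (xs i) \<le> 2 * t) \<and> (\<forall>i<N. nm (- xs i + xs (Suc i)) \<le> b)"
    using wc unfolding well_connected_def by metis
  obtain A where A: "A \<ge> 1" "\<And>t. t > 0 \<Longrightarrow> V (3 / \<delta> * t) \<le> A * V t"
    using V_dilation[of "3 / \<delta>"] \<open>\<delta> > 0\<close> by auto
  obtain D where D: "D \<ge> 1" "\<And>t. t > 0 \<Longrightarrow> V ((6 * \<kappa> / \<delta> + 1) * t) \<le> D * V t"
    using V_dilation[of "6 * \<kappa> / \<delta> + 1"] \<open>\<delta> > 0\<close> \<open>\<kappa> > 0\<close> by (auto simp: add_pos_pos)
  obtain n1 where n1: "n1 \<ge> 1" "\<And>n. n \<ge> n1 \<Longrightarrow> 3 * b / \<delta> \<le> r (real n)"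
    using scale_unbounded by blast
  define M where "M = nat \<lceil>D\<rceil>"
  define \<theta> where "\<theta> = 1 / A"
  have \<theta>: "\<theta> > 0" using A by (simp add: \<theta>_def)
  define c2 where "c2 = \<theta> * (\<theta> * c * c) * (\<theta> * c * c)"
  have c2: "c2 > 0" using \<theta> \<open>c > 0\<close> by (simp add: c2_def)
  show ?thesis
  proof (rule that[of "4 * Suc (2 * M)" n1 "c2 * (\<theta> * c2) ^ (2 * M)"])
    show "c2 * (\<theta> * c2) ^ (2 * M) > 0" using \<theta> c2 by simp
    fix n g assume n: "n \<ge> n1" and g: "nm g \<le> \<kappa> * r (real n)"
    have n': "n \<ge> 1" using n n1 by simp
    define R where "R = \<delta> / 3 * r (real n)"
    have rn: "r (real n) > 0" using n' by (simp add: r_pos)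
    have R: "R > 0" using rn \<open>\<delta> > 0\<close> by (simp add: R_def)
    have bR: "b \<le> R" using n1(2)[OF n] \<open>\<delta> > 0\<close> by (simp add: R_def field_simps)
    have vol: "\<theta> * W (real n) \<le> V R"
      using A(2)[OF R] A(1) \<open>\<delta> > 0\<close> by (simp add: \<theta>_def R_def W_def field_simps)
    have t: "\<kappa> * r (real n) > 0" using rn \<open>\<kappa> > 0\<close> by simp
    obtain N and xs :: "nat \<Rightarrow> 'a" where xs: "xs 0 = 0" "xs N = g"
      "\<And>i. i \<le> N \<Longrightarrow> nm (xs i) \<le> 2 * (\<kappa> * r (real n))" "\<And>i. i < N \<Longrightarrow> nm (- xs i + xs (Suc i)) \<le> b"
      using b(2)[OF t g] by blast
    obtain ys where ys: "ys 0 = 0" "ys (2 * M) = g" "\<And>i. i < 2 * M \<Longrightarrow> touching R (ys i) (ys (Suc i))"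
    proof (rule short_chain[of "nball (2 * (\<kappa> * r (real n)))" xs 0 N g R M])
      show "finite (nball (2 * (\<kappa> * r (real n))))" using t by (simp add: finite_nball)
      show "xs i \<in> nball (2 * (\<kappa> * r (real n)))" if "i \<le> N" for i
        using xs(3)[OF that] by (simp add: nball_def)
      show "touching R (xs i) (xs (Suc i))" if "i < N" for i
        unfolding touching_def
      proof (intro bexI)
        show "xs i + (- xs i + xs (Suc i)) = xs (Suc i) + 0" by (simp add: add.assoc[symmetric])
      qed (use xs(4)[OF that] bR R in \<open>auto simp: nball_def\<close>)
      show "card Z \<le> M" if "Z \<subseteq> nball (2 * (\<kappa> * r (real n)))" "pairwise (\<lambda>x y. \<not> touching R x y) Z" for Z
      proof (rule packing_bound[OF R _ _ that])
        have "2 * (\<kappa> * r (real n)) + R = (6 * \<kappa> / \<delta> + 1) * R"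
          using \<open>\<delta> > 0\<close> by (simp add: R_def field_simps)
        then have "V (2 * (\<kappa> * r (real n)) + R) \<le> D * V R" using D(2)[OF R] by simp
        also have "\<dots> \<le> real M * V R" using V_pos[OF R] by (intro mult_right_mono) (auto simp: M_def real_nat_ceiling_ge)
        finally show "V (2 * (\<kappa> * r (real n)) + R) \<le> real M * V R" .
      qed (use t in simp)
    qed (use xs R in auto)
    have "c2 * (\<theta> * c2) ^ (2 * M) / W (real n) \<le> p (8 * n * Suc (2 * M)) (ys (2 * M) + 0)"
    proof (rule chain_lower_bound[OF R vol n', where N = "2 * M"])
      show "c2 / W (real n) \<le> p (8 * n) (- k + - x + y + k')"
        if "touching R x y" "k \<in> nball R" "k' \<in> nball R" for x y k k'
        unfolding c2_def
        by (rule touching_lower_bound[OF R vol n'])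
          (use that near[OF n'] \<theta> \<open>c > 0\<close> in \<open>auto simp: R_def\<close>)
    qed (use ys \<theta> c2 R in \<open>auto simp: nball_def\<close>)
    moreover have "8 * n * Suc (2 * M) = 2 * n * (4 * Suc (2 * M))" by (simp add: algebra_simps)
    ultimately show "c2 * (\<theta> * c2) ^ (2 * M) / W (real n) \<le> p (2 * n * (4 * Suc (2 * M))) g"
      by (simp only: ys(2) add_0_right)
  qed (use n1 in auto)
qed

section \<open>The lower bound at distances comparable with the scale\<close>

text \<open>
  Up to a bounded remainder $n = 3t$ with $t = K m$. Chaining supplies lower bounds at time $2tL$
  throughout a ball of radius $\kappa' r(t)$; extrapolation with base time $2t$, step $2m$ and
  $d = K$ transfers them to the sum of the densities at the times $2t + 2mi$, $i \le K$. From there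
  the near-diagonal bound leads to $g$ at the common time $6t$.
\<close>

lemma full_lower_bound:
  assumes wc: "well_connected nm" and \<delta>: "\<delta> > 0" and c: "c > 0"
    and near: "\<And>n g. n \<ge> 1 \<Longrightarrow> nm g \<le> \<delta> * r (real n) \<Longrightarrow> c / W (real n) \<le> p (2 * n) g"
    and \<kappa>: "\<kappa> > 0"
  obtains n0 c' where "n0 \<ge> 1" "c' > 0"
    and "\<And>n g. n \<ge> n0 \<Longrightarrow> nm g \<le> \<kappa> * r (real n) \<Longrightarrow> c' / W (real n) \<le> p (2 * n) g"
proof -
  obtain A where A: "A \<ge> 1" "\<And>t. t > 0 \<Longrightarrow> r (6 * t) \<le> A * r t" using r_dilation[of 6] by auto
  have \<kappa>A: "\<kappa> * A + \<delta> > 0" using \<kappa> A(1) \<delta> by (intro add_pos_pos mult_pos_pos) auto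
  \<comment> \<open>The radius leaves room for translates $g + h$ with $\|h\| \le \delta r(t)$.\<close>
  obtain L n1 c1 where L: "L \<ge> 1" and n1: "n1 \<ge> 1" and c1: "c1 > 0" and late:
    "\<And>n g. n \<ge> n1 \<Longrightarrow> nm g \<le> (\<kappa> * A + \<delta>) * r (real n) \<Longrightarrow> c1 / W (real n) \<le> p (2 * n * L) g"
    using chaining[OF wc \<delta> c \<kappa>A near] by blast
  obtain L' where L': "L = Suc L'" using L by (cases L) auto
  obtain C0 where C0: "C0 > 0" "\<And>n. n \<ge> 1 \<Longrightarrow> p (2 * n) 0 \<le> C0 / W (real n)"
    using on_diagonal_bounds by metis
  obtain D where D: "D \<ge> 1" "\<And>t. t > 0 \<Longrightarrow> V (1 / \<delta> * t) \<le> D * V t"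
    using V_dilation[of "1 / \<delta>"] \<delta> by auto
  \<comment> \<open>The extrapolation error is $(L - 1) / K$ times the on-diagonal upper bound; this choice of $K$
     makes it at most half of the bound from chaining.\<close>
  define K where "K = nat \<lceil>2 * real L' * C0 / c1\<rceil> + 1"
  have K: "K > 0" by (simp add: K_def)
  have KC: "real L' / real K * C0 \<le> c1 / 2"
  proof -
    have "2 * real L' * C0 / c1 \<le> real K" unfolding K_def by linarith
    then show ?thesis using K c1 by (simp add: field_simps)
  qed
  obtain \<Gamma> where \<Gamma>: "\<Gamma> > 0" and extrapolate: "\<And>n s N g. p (2 * n + s * N) g
      \<le> \<Gamma> * (\<Sum>i\<le>K. p (2 * n + s * i) g) + real N / (real K)\<^sup>2 * p (2 * n) 0"
    using time_extrapolation[OF K] by blast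
  define c' where "c' = pmf \<nu> 0 ^ (6 * K) * (c1 / (2 * \<Gamma>) * c / (D * real (K + 1)))"
  show ?thesis
  proof (rule that[of "3 * K * (n1 + 1)" c'])
    show "3 * K * (n1 + 1) \<ge> 1" using K by simp
    show "c' > 0" unfolding c'_def using lazy c c1 \<Gamma> D(1) by (auto intro!: mult_pos_pos divide_pos_pos)
    fix n g assume n: "n \<ge> 3 * K * (n1 + 1)" and g: "nm g \<le> \<kappa> * r (real n)"
    define m where "m = n div (3 * K)"
    define i0 where "i0 = n mod (3 * K)"
    have n_eq: "n = 3 * (K * m) + i0"
      using mult_div_mod_eq[of "3 * K" n] by (simp only: m_def i0_def mult.assoc)
    have i0: "i0 < 3 * K" using K by (simp add: i0_def)
    have m: "m \<ge> n1 + 1"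
      using div_le_mono[OF n, of "3 * K"] K by (simp add: m_def)
    have m_le: "m \<le> K * m" using K by (cases K) auto
    define t where "t = K * m"
    have t: "t \<ge> 1" "t \<ge> n1" using m m_le unfolding t_def by linarith+
    have t6: "n \<le> 6 * t"
    proof -
      have "K * 1 \<le> K * m" using m by (intro mult_le_mono2) simp
      then show ?thesis using n_eq i0 unfolding t_def by linarith
    qed
    have t2: "2 * t \<le> n" using n_eq by (simp add: t_def)
    have rt: "r (real t) > 0" and Wt: "W (real t) > 0" using t by (auto simp: r_pos W_pos)
    define R where "R = \<delta> * r (real t)"
    have R: "R > 0" using \<delta> rt by (simp add: R_def)
    have vol: "W (real t) \<le> D * V R" using D(2)[OF R] \<delta> by (simp add: R_def W_def)
    have g': "nm g \<le> \<kappa> * A * r (real t)"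
    proof -
      have "r (real n) \<le> r (6 * real t)" using t6 n K t2 t by (intro r_mono) auto
      also have "\<dots> \<le> A * r (real t)" using t by (intro A(2)) simp
      finally have "\<kappa> * r (real n) \<le> \<kappa> * (A * r (real t))" using \<kappa> by (intro mult_left_mono) auto
      with g show ?thesis by simp
    qed
    have early: "c1 / (2 * \<Gamma>) / W (real t) \<le> (\<Sum>i\<le>K. p (2 * t + 2 * m * i) z)"
      if "nm z \<le> (\<kappa> * A + \<delta>) * r (real t)" for z
    proof -
      have "2 * t + 2 * m * (L' * K) = 2 * t * L" by (simp add: L' t_def algebra_simps)
      then have "c1 / W (real t) \<le> p (2 * t + 2 * m * (L' * K)) z" using late[OF t(2) that] by simp
      also have "\<dots> \<le> \<Gamma> * (\<Sum>i\<le>K. p (2 * t + 2 * m * i) z) + real (L' * K) / (real K)\<^sup>2 * p (2 * t) 0"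
        by (rule extrapolate)
      also have "real (L' * K) / (real K)\<^sup>2 = real L' / real K" using K by (simp add: power2_eq_square)
      also have "real L' / real K * p (2 * t) 0 \<le> real L' / real K * (C0 / W (real t))"
        using t C0(2)[of t] by (intro mult_left_mono) auto
      also have "\<dots> \<le> c1 / 2 / W (real t)"
        using divide_right_mono[OF KC, of "W (real t)"] Wt by simp
      finally have "c1 / W (real t) \<le> \<Gamma> * (\<Sum>i\<le>K. p (2 * t + 2 * m * i) z) + c1 / 2 / W (real t)" by simp
      moreover have "c1 / W (real t) = c1 / 2 / W (real t) + c1 / 2 / W (real t)" by simp
      ultimately have "c1 / 2 / W (real t) \<le> \<Gamma> * (\<Sum>i\<le>K. p (2 * t + 2 * m * i) z)" by linarith
      then have "c1 / 2 / W (real t) / \<Gamma> \<le> (\<Sum>i\<le>K. p (2 * t + 2 * m * i) z)"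
        unfolding pos_divide_le_eq[OF \<Gamma>] by (simp only: mult.commute)
      then show ?thesis by (simp only: divide_divide_eq_left mult_ac)
    qed
    \<comment> \<open>The time left, $6t - (2t + 2mi) = 2s$, satisfies $t \le s \le 2t$, so that the near-diagonal bound
       applies to the last piece uniformly in $i$.\<close>
    have finish: "(\<Sum>h\<in>nball R. p (2 * t + 2 * m * i) (g + h) * (c / W (real n))) \<le> p (6 * t) g"
      if i: "i \<le> K" for i
    proof -
      define s where "s = (2 * K - i) * m"
      have s: "t \<le> s" "s \<le> 2 * t" "2 * t + 2 * m * i + 2 * s = 6 * t"
      proof -
        have "K \<le> 2 * K - i" using i by simp
        then show "t \<le> s" unfolding t_def s_def by (rule mult_le_mono1)
        have "2 * K - i \<le> 2 * K" by simp
        then have "(2 * K - i) * m \<le> 2 * K * m" by (rule mult_le_mono1)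
        then show "s \<le> 2 * t" by (simp add: t_def s_def)
        have "i * m + s = (i + (2 * K - i)) * m" unfolding s_def by (rule add_mult_distrib[symmetric])
        also have "i + (2 * K - i) = 2 * K" using i by simp
        finally show "2 * t + 2 * m * i + 2 * s = 6 * t" by (simp add: t_def algebra_simps)
      qed
      have "(\<Sum>h\<in>nball R. p (2 * t + 2 * m * i) (g + h) * (c / W (real n)))
          \<le> (\<Sum>h\<in>nball R. p (2 * t + 2 * m * i) (g + h) * p (2 * s) (- (g + h) + g))"
      proof (intro sum_mono mult_left_mono)
        fix h assume h: "h \<in> nball R"
        have "nm h \<le> \<delta> * r (real s)"
        proof -
          have "\<delta> * r (real t) \<le> \<delta> * r (real s)"
            using t s \<delta> by (intro mult_left_mono r_mono) auto
          with h show ?thesis by (simp add: nball_def R_def)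
        qed
        then have "c / W (real s) \<le> p (2 * s) h" using t s by (intro near) auto
        moreover have "c / W (real n) \<le> c / W (real s)"
          using c t t2 s by (intro divide_left_mono W_mono mult_pos_pos W_pos) auto
        moreover have "- (g + h) + g = - h" by (simp only: minus_add add.assoc left_minus add_0_right)
        ultimately show "c / W (real n) \<le> p (2 * s) (- (g + h) + g)" by (simp add: p_minus)
      qed simp
      also have "\<dots> = (\<Sum>x\<in>(\<lambda>h. g + h) ` nball R. p (2 * t + 2 * m * i) x * p (2 * s) (- x + g))"
        by (subst sum.reindex) (auto simp: inj_on_def)
      also have "\<dots> \<le> p (2 * t + 2 * m * i + 2 * s) g"
        by (intro conv_power_partial_sum finite_imageI finite_nball R)
      finally show ?thesis by (simp only: s(3))
    qed
    have "real (card (nball R)) * (c1 / (2 * \<Gamma>) / W (real t) * (c / W (real n)))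
        \<le> (\<Sum>h\<in>nball R. (\<Sum>i\<le>K. p (2 * t + 2 * m * i) (g + h)) * (c / W (real n)))"
    proof (intro sum_bounded_below mult_right_mono early)
      fix h assume "h \<in> nball R"
      then show "nm (g + h) \<le> (\<kappa> * A + \<delta>) * r (real t)"
        using g' nm_add[of g h] by (simp add: nball_def R_def distrib_right)
      show "0 \<le> c / W (real n)" using c t t2 by (simp add: W_pos less_imp_le)
    qed
    also have "\<dots> = (\<Sum>i\<le>K. \<Sum>h\<in>nball R. p (2 * t + 2 * m * i) (g + h) * (c / W (real n)))"
      unfolding sum_distrib_right by (rule sum.swap)
    also have "\<dots> \<le> (\<Sum>i\<le>K. p (6 * t) g)" using finish by (intro sum_mono) auto
    also have "\<dots> = real (K + 1) * p (6 * t) g" by simp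
    finally have total: "V R * (c1 / (2 * \<Gamma>) / W (real t) * (c / W (real n))) \<le> real (K + 1) * p (6 * t) g"
      by (simp only: V_card)
    have "c1 / (2 * \<Gamma>) * c / D / W (real n)
        = W (real t) / D * (c1 / (2 * \<Gamma>) / W (real t) * (c / W (real n)))" using Wt by simp
    also have "\<dots> \<le> V R * (c1 / (2 * \<Gamma>) / W (real t) * (c / W (real n)))"
      using vol D(1) c c1 \<Gamma> Wt t t2
      by (intro mult_right_mono) (auto simp: divide_le_eq mult.commute W_pos less_imp_le)
    also note total
    finally have "c1 / (2 * \<Gamma>) * c / D / W (real n) \<le> p (6 * t) g * real (K + 1)"
      by (simp only: mult.commute)
    moreover have "real (K + 1) > 0" by simp
    ultimately have "c1 / (2 * \<Gamma>) * c / D / W (real n) / real (K + 1) \<le> p (6 * t) g"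
      by (simp only: pos_divide_le_eq)
    also have "c1 / (2 * \<Gamma>) * c / D / W (real n) / real (K + 1)
        = c1 / (2 * \<Gamma>) * c / (D * real (K + 1)) / W (real n)"
      by (simp only: divide_divide_eq_left mult_ac)
    finally have spread: "c1 / (2 * \<Gamma>) * c / (D * real (K + 1)) / W (real n) \<le> p (6 * t) g" .
    have "pmf \<nu> 0 ^ (6 * K) * (c1 / (2 * \<Gamma>) * c / (D * real (K + 1)) / W (real n))
        \<le> pmf \<nu> 0 ^ (2 * i0) * p (6 * t) g"
    proof (rule mult_mono[OF power_decreasing spread])
      show "2 * i0 \<le> 6 * K" using i0 by simp
    qed (use c c1 \<Gamma> D(1) t t2 lazy in \<open>auto simp: pmf_le_1 W_pos less_imp_le\<close>)
    also have "\<dots> \<le> p (6 * t + 2 * i0) g" by (rule conv_power_hold)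
    also have "6 * t + 2 * i0 = 2 * n" using n_eq by (simp add: t_def)
    finally show "c' / W (real n) \<le> p (2 * n) g" by (simp add: c'_def)
  qed
qed

text \<open>
  The density at $-x + y$ is bounded below by \<open>difference_lower_bound\<close> with intermediate points in
  the ball of radius $\tau$ itself, whose volume is at least $W(m)$ for $m = \lfloor n / 4\rfloor$.
  A short walk may simply not move.
\<close>

lemma stay_in_ball:
  assumes full: "\<And>\<kappa>. \<kappa> > 0 \<Longrightarrow> \<exists>n0 c. n0 \<ge> 1 \<and> c > 0 \<and>
      (\<forall>n g. n \<ge> n0 \<longrightarrow> nm g \<le> \<kappa> * r (real n) \<longrightarrow> c / W (real n) \<le> p (2 * n) g)"
  obtains c where "c > 0"
    and "\<And>n \<tau> x. n \<ge> 1 \<Longrightarrow> r (real n) \<le> \<tau> \<Longrightarrow> \<tau> \<le> r (2 * real n) \<Longrightarrow> nm x \<le> \<tau> \<Longrightarrow>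
      c \<le> (\<Sum>y\<in>nball \<tau>. p n (- x + y))"
proof -
  obtain A where A: "A \<ge> 1" "\<And>t. t > 0 \<Longrightarrow> r (16 * t) \<le> A * r t" using r_dilation[of 16] by auto
  obtain n0 c where n0: "n0 \<ge> 1" and c: "c > 0" and
    low: "\<And>n g. n \<ge> n0 \<Longrightarrow> nm g \<le> 2 * A * r (real n) \<Longrightarrow> c / W (real n) \<le> p (2 * n) g"
    using full[of "2 * A"] A(1) by auto
  define c' where "c' = min (pmf \<nu> 0 ^ 3 * (c * c)) (pmf \<nu> 0 ^ (4 * (n0 + 1)))"
  show ?thesis
  proof (rule that[of c'])
    show "c' > 0" using lazy c by (simp add: c'_def)
    fix n \<tau> x assume n: "n \<ge> 1" and \<tau>: "r (real n) \<le> \<tau>" "\<tau> \<le> r (2 * real n)" and x: "nm x \<le> \<tau>"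
    have \<tau>0: "\<tau> > 0" using \<tau> r_pos[of "real n"] n by linarith
    show "c' \<le> (\<Sum>y\<in>nball \<tau>. p n (- x + y))"
    proof (cases "n \<ge> 4 * (n0 + 1)")
      case True
      define m where "m = n div 4"
      define i where "i = n mod 4"
      have n_eq: "n = 4 * m + i" and i: "i \<le> 3" and m: "m \<ge> n0" "m \<ge> 1"
        using True n0 by (auto simp: m_def i_def)
      have "\<tau> \<le> r (16 * real m)" using \<tau>(2) n m n_eq i r_mono[of "2 * real n" "16 * real m"] by linarith
      also have "\<dots> \<le> A * r (real m)" using m by (intro A) simp
      finally have \<tau>m: "2 * \<tau> \<le> 2 * A * r (real m)" by simp
      have vol: "W (real m) \<le> V \<tau>"
      proof -
        have "r (real m) \<le> \<tau>" using \<tau>(1) r_mono[of "real m" "real n"] m n_eq by linarith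
        then show ?thesis unfolding W_def using m by (intro V_mono r_pos) auto
      qed
      have Wm: "W (real m) > 0" using m by (simp add: W_pos)
      have "pmf \<nu> 0 ^ 3 * (c * c / W (real m)) \<le> p n (- x + y)" if y: "y \<in> nball \<tau>" for y
      proof -
        have "1 * c * c / W (real m) \<le> p (2 * m + 2 * m) (- x + y)"
        proof (rule difference_lower_bound[OF \<tau>0])
          fix w assume "w \<in> nball \<tau>"
          then show "c / W (real m) \<le> p (2 * m) (w + x) \<and> c / W (real m) \<le> p (2 * m) (w + y)"
            using x y \<tau>m m nm_add[of w x] nm_add[of w y] by (intro conjI low) (auto simp: nball_def)
        qed (use vol m c in auto)
        then have "pmf \<nu> 0 ^ 3 * (c * c / W (real m)) \<le> pmf \<nu> 0 ^ i * p (4 * m) (- x + y)"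
          using i lazy c Wm by (intro mult_mono power_decreasing) (auto simp: pmf_le_1)
        also have "\<dots> \<le> p n (- x + y)" unfolding n_eq by (rule conv_power_hold)
        finally show ?thesis .
      qed
      then have "real (card (nball \<tau>)) * (pmf \<nu> 0 ^ 3 * (c * c / W (real m))) \<le> (\<Sum>y\<in>nball \<tau>. p n (- x + y))"
        by (intro sum_bounded_below) auto
      moreover have "pmf \<nu> 0 ^ 3 * (c * c) \<le> real (card (nball \<tau>)) * (pmf \<nu> 0 ^ 3 * (c * c / W (real m)))"
      proof -
        have "pmf \<nu> 0 ^ 3 * (c * c) = W (real m) * (pmf \<nu> 0 ^ 3 * (c * c / W (real m)))" using Wm by simp
        also have "\<dots> \<le> V \<tau> * (pmf \<nu> 0 ^ 3 * (c * c / W (real m)))"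
          using vol Wm c lazy by (intro mult_right_mono) auto
        finally show ?thesis by (simp only: V_card)
      qed
      ultimately show ?thesis by (simp add: c'_def min_le_iff_disj)
    next
      case False
      have "pmf \<nu> 0 ^ (4 * (n0 + 1)) \<le> pmf \<nu> 0 ^ n"
        using False lazy by (intro power_decreasing) (auto simp: pmf_le_1)
      also have "\<dots> \<le> p n (- x + x)" using conv_power_hold[of \<nu> n 0 0] by simp
      also have "\<dots> \<le> (\<Sum>y\<in>nball \<tau>. p n (- x + y))"
        using x by (intro member_le_sum[of x "nball \<tau>" "\<lambda>y. p n (- x + y)"] finite_nball \<tau>0) (auto simp: nball_def)
      finally show ?thesis by (simp add: c'_def min_le_iff_disj)
    qed
  qed
qed

end

section \<open>The path measure\<close>

lemma walk_0 [simp]: "walk x 0 \<omega> = x"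
  by (simp add: walk_def)

lemma walk_Suc: "walk x (Suc n) \<omega> = walk x n \<omega> + \<omega> !! n"
  by (simp add: walk_def stake_Suc add.assoc del: stake.simps)

lemma walk_Cons: "walk x (Suc n) (t ## \<omega>) = walk (x + t) n \<omega>"
  by (simp add: walk_def add.assoc)

lemma walk_translate: "walk x k \<omega> = x + walk 0 k \<omega>"
  by (simp add: walk_def)

lemma space_steps [simp]: "space (steps \<nu>) = UNIV"
  by (simp add: steps_def space_stream_space)

lemma prob_space_steps: "prob_space (steps \<nu>)"
  unfolding steps_def by (rule prob_space.prob_space_stream_space[OF prob_space_measure_pmf])

context normed_walk
begin

lemma countable_group: "countable (UNIV :: 'a set)"
proof -
  have "g \<in> (\<Union>n. nball (real (Suc n)))" for g
  proof -
    obtain n where "nm g < real n" using reals_Archimedean2 by blast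
    then have "g \<in> nball (real (Suc n))" by (simp add: nball_def)
    then show ?thesis by blast
  qed
  then have "(UNIV :: 'a set) = (\<Union>n. nball (real (Suc n)))" by blast
  moreover have "countable (\<Union>n. nball (real (Suc n)))"
    by (rule countable_UN) (auto intro!: countable_finite finite_nball)
  ultimately show ?thesis by simp
qed

lemma measurable_walk: "walk x k \<in> measurable (steps \<nu>) (count_space UNIV)"
proof (induction k)
  case (Suc k)
  have "(\<lambda>\<omega>. \<omega> !! k) \<in> measurable (steps \<nu>) (count_space UNIV)"
    using measurable_snth[of k "measure_pmf \<nu>"] by (simp add: steps_def)
  with Suc have "(\<lambda>\<omega>. (walk x k \<omega>, \<omega> !! k)) \<in> measurable (steps \<nu>) (count_space UNIV \<Otimes>\<^sub>M count_space UNIV)"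
    by (rule measurable_Pair)
  then have "(\<lambda>\<omega>. (walk x k \<omega>, \<omega> !! k)) \<in> measurable (steps \<nu>) (count_space (UNIV \<times> UNIV))"
    by (simp only: pair_measure_countable[OF countable_group countable_group])
  then have "(\<lambda>\<omega>. (\<lambda>(y, s). y + s) (walk x k \<omega>, \<omega> !! k)) \<in> measurable (steps \<nu>) (count_space UNIV)"
    by (rule measurable_compose) simp
  then show ?case by (simp add: walk_Suc[abs_def] fun_eq_iff)
qed (simp add: walk_def)

lemma walk_event: "{\<omega>. P (walk x k \<omega>)} \<in> sets (steps \<nu>)"
  using measurable_sets[OF measurable_walk, of "Collect P" x k] by (simp add: vimage_def)

text \<open>
  The law of the path is built by prepending increments, the convolution power by appending them;
  the two agree because powers of $\nu$ commute.
\<close>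

lemma prob_walk: "measure (steps \<nu>) {\<omega>. walk x n \<omega> = y} = p n (- x + y)"
proof (induction n arbitrary: x)
  case 0
  interpret prob_space "steps \<nu>" by (rule prob_space_steps)
  have "x = y \<longleftrightarrow> - x + y = 0" by (metis add.right_neutral add_minus_cancel left_minus)
  then show ?case using prob_space by (auto simp: pmf_return indicator_def)
next
  case (Suc n)
  have meas: "{\<omega> \<in> space (stream_space (measure_pmf \<nu>)). walk x (Suc n) \<omega> = y}
      \<in> sets (stream_space (measure_pmf \<nu>))"
    using walk_event[of "\<lambda>z. z = y" x "Suc n"] by (simp add: steps_def space_stream_space)
  have "ennreal (measure (steps \<nu>) {\<omega>. walk x (Suc n) \<omega> = y})
      = (\<integral>\<^sup>+t. ennreal (measure (steps \<nu>) {\<omega>. walk x (Suc n) (t ## \<omega>) = y}) \<partial>measure_pmf \<nu>)"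
    using prob_space.prob_stream_space[OF prob_space_measure_pmf meas] by (simp add: steps_def space_stream_space)
  also have "\<dots> = (\<integral>\<^sup>+t. ennreal (p n (- t + (- x + y))) \<partial>measure_pmf \<nu>)"
    by (simp add: walk_Cons Suc minus_add add.assoc del: add_uminus_conv_diff)
  also have "\<dots> = ennreal (pmf (convolve \<nu> (conv_power n \<nu>)) (- x + y))"
    unfolding convolve_bind ennreal_pmf_bind by (simp add: pmf_translate)
  also have "convolve \<nu> (conv_power n \<nu>) = conv_power (Suc n) \<nu>"
    using conv_power_add[of 1 n \<nu>] by simp
  finally show ?case by (simp del: conv_power.simps)
qed

lemma prob_walk_in_ball:
  assumes "\<tau> > 0"
  shows "measure (steps \<nu>) {\<omega>. nm (walk x n \<omega>) \<le> \<tau>} = (\<Sum>y\<in>nball \<tau>. p n (- x + y))"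
proof -
  interpret prob_space "steps \<nu>" by (rule prob_space_steps)
  have "{\<omega>. nm (walk x n \<omega>) \<le> \<tau>} = (\<Union>y\<in>nball \<tau>. {\<omega>. walk x n \<omega> = y})" by (auto simp: nball_def)
  also have "measure (steps \<nu>) \<dots> = (\<Sum>y\<in>nball \<tau>. measure (steps \<nu>) {\<omega>. walk x n \<omega> = y})"
    using finite_nball[OF assms] walk_event
    by (intro finite_measure_finite_Union) (auto simp: disjoint_family_on_def)
  finally show ?thesis by (simp only: prob_walk)
qed

lemma sup_walk_eq: "(SUP k\<in>{0..n}. nm (walk x k \<omega>)) = Max ((\<lambda>k. nm (walk x k \<omega>)) ` {0..n})"
  by (intro cSup_eq_Max) auto

lemma sup_walk_le_event: "{\<omega>. (SUP k\<in>{0..n}. nm (walk x k \<omega>)) \<le> b} \<in> sets (steps \<nu>)"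
proof -
  have "{\<omega>. (SUP k\<in>{0..n}. nm (walk x k \<omega>)) \<le> b} = space (steps \<nu>) \<inter> (\<Inter>k\<in>{0..n}. {\<omega>. nm (walk x k \<omega>) \<le> b})"
    unfolding sup_walk_eq by auto
  also have "\<dots> \<in> sets (steps \<nu>)"
    by (intro sets.Int sets.finite_INT walk_event sets.top) auto
  finally show ?thesis .
qed

lemma sup_walk_ge_event: "{\<omega>. b \<le> (SUP k\<in>{0..n}. nm (walk x k \<omega>))} \<in> sets (steps \<nu>)"
proof -
  have "{\<omega>. b \<le> (SUP k\<in>{0..n}. nm (walk x k \<omega>))} = (\<Union>k\<in>{0..n}. {\<omega>. b \<le> nm (walk x k \<omega>)})"
    unfolding sup_walk_eq by (auto simp: Max_ge_iff)
  also have "\<dots> \<in> sets (steps \<nu>)" by (intro sets.finite_UN walk_event) auto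
  finally show ?thesis .
qed

text \<open>
  A path from $x$ leaving the ball of radius $(1 + \gamma)\tau$ has increments whose partial sums
  leave the ball of radius $\gamma r(n)$, because $\|x\| \le \tau$ and $r(n) \le \tau$.
\<close>

lemma prob_confined:
  assumes c: "c > 0" and n: "n \<ge> 1" and \<tau>: "r (real n) \<le> \<tau>" and x: "nm x \<le> \<tau>"
    and stay: "c \<le> (\<Sum>y\<in>nball \<tau>. p n (- x + y))"
    and tight: "measure (steps \<nu>) {\<omega>. \<gamma> * r (real n) \<le> (SUP k\<in>{0..n}. nm (walk 0 k \<omega>))} \<le> c / 2"
    and \<gamma>: "\<gamma> > 0"
  shows "c / 2 \<le> measure (steps \<nu>)
    {\<omega>. (SUP k\<in>{0..n}. nm (walk x k \<omega>)) \<le> (1 + \<gamma>) * \<tau> \<and> nm (walk x n \<omega>) \<le> \<tau>}"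
proof -
  interpret prob_space "steps \<nu>" by (rule prob_space_steps)
  let ?good = "{\<omega>. (SUP k\<in>{0..n}. nm (walk x k \<omega>)) \<le> (1 + \<gamma>) * \<tau> \<and> nm (walk x n \<omega>) \<le> \<tau>}"
  let ?far = "{\<omega>. \<gamma> * r (real n) \<le> (SUP k\<in>{0..n}. nm (walk 0 k \<omega>))}"
  have \<tau>0: "\<tau> > 0" using \<tau> r_pos[of "real n"] n by linarith
  have good: "?good \<in> sets (steps \<nu>)"
    using sets.Int[OF sup_walk_le_event[of x n "(1 + \<gamma>) * \<tau>"] walk_event[of "\<lambda>y. nm y \<le> \<tau>" x n]]
    by (simp add: Int_def)
  have "{\<omega>. nm (walk x n \<omega>) \<le> \<tau>} \<subseteq> ?good \<union> ?far"
  proof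
    fix \<omega> assume end_in: "\<omega> \<in> {\<omega>. nm (walk x n \<omega>) \<le> \<tau>}"
    show "\<omega> \<in> ?good \<union> ?far"
    proof (cases "\<omega> \<in> ?far")
      case False
      have "nm (walk x k \<omega>) \<le> (1 + \<gamma>) * \<tau>" if "k \<le> n" for k
      proof -
        have "nm (walk 0 k \<omega>) < \<gamma> * r (real n)"
          using False that unfolding sup_walk_eq by (auto simp: not_le)
        also have "\<dots> \<le> \<gamma> * \<tau>" using \<tau> \<gamma> by simp
        finally show ?thesis using nm_add[of x "walk 0 k \<omega>"] x
          by (simp add: walk_translate[of x] distrib_right)
      qed
      then show ?thesis using end_in unfolding sup_walk_eq by auto
    qed simp
  qed
  then have "measure (steps \<nu>) {\<omega>. nm (walk x n \<omega>) \<le> \<tau>} \<le> measure (steps \<nu>) (?good \<union> ?far)"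
    using good sup_walk_ge_event by (intro finite_measure_mono) auto
  also have "\<dots> \<le> measure (steps \<nu>) ?good + measure (steps \<nu>) ?far"
    using good sup_walk_ge_event by (intro measure_subadditive) auto
  finally show ?thesis using stay tight by (simp add: prob_walk_in_ball[OF \<tau>0])
qed

lemma confinement:
  assumes full: "\<And>\<kappa>. \<kappa> > 0 \<Longrightarrow> \<exists>n0 c. n0 \<ge> 1 \<and> c > 0 \<and>
      (\<forall>n g. n \<ge> n0 \<longrightarrow> nm g \<le> \<kappa> * r (real n) \<longrightarrow> c / W (real n) \<le> p (2 * n) g)"
    and tight: "\<And>\<epsilon>. \<epsilon> > 0 \<Longrightarrow> \<exists>\<gamma>>0. \<forall>n\<ge>1. measure (steps \<nu>)
      {\<omega>\<in>space (steps \<nu>). (SUP k\<in>{0..n}. nm (walk 0 k \<omega>)) \<ge> \<gamma> * r (real n)} \<le> \<epsilon>"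
  shows "\<exists>\<epsilon>>0. \<exists>\<gamma>1>0. \<exists>\<gamma>2\<ge>1. \<forall>n::nat. \<forall>\<tau>>0.
        (1/2) * inverse_scale r (\<tau> / \<gamma>1) \<le> real n \<and> real n \<le> inverse_scale r (\<tau> / \<gamma>1) \<longrightarrow>
        (INF x\<in>{x. nm x \<le> \<tau>}.
           measure (steps \<nu>)
             {\<omega>\<in>space (steps \<nu>).
                (SUP k\<in>{0..n}. nm (walk x k \<omega>)) \<le> \<gamma>2 * \<tau> \<and> nm (walk x n \<omega>) \<le> \<tau>})
          \<ge> \<epsilon>"
proof -
  obtain c where c: "c > 0" and stay: "\<And>n \<tau> x. n \<ge> 1 \<Longrightarrow> r (real n) \<le> \<tau> \<Longrightarrow> \<tau> \<le> r (2 * real n) \<Longrightarrow>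
      nm x \<le> \<tau> \<Longrightarrow> c \<le> (\<Sum>y\<in>nball \<tau>. p n (- x + y))"
    using stay_in_ball[OF full] by blast
  obtain \<gamma> where \<gamma>: "\<gamma> > 0" and far: "\<And>n. n \<ge> 1 \<Longrightarrow> measure (steps \<nu>)
      {\<omega>. \<gamma> * r (real n) \<le> (SUP k\<in>{0..n}. nm (walk 0 k \<omega>))} \<le> c / 2"
    using tight[of "c / 2"] c by auto
  show ?thesis
  proof (rule exI[of _ "c / 2"], rule conjI, simp add: c, rule exI[of _ "1 :: real"], rule conjI, simp,
      rule exI[of _ "1 + \<gamma>"], intro conjI allI impI)
    fix n :: nat and \<tau> :: real
    assume \<tau>: "\<tau> > 0"
      and "(1/2) * inverse_scale r (\<tau> / 1) \<le> real n \<and> real n \<le> inverse_scale r (\<tau> / 1)"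
    then have lower: "inverse_scale r \<tau> \<le> 2 * real n" and upper: "real n \<le> inverse_scale r \<tau>" by auto
    have n: "n \<ge> 1" using inverse_scale_pos_eq(1)[OF \<tau>] lower by (cases n) auto
    have scales: "r (real n) \<le> \<tau>" "\<tau> \<le> r (2 * real n)"
      using r_mono[OF _ upper] r_mono[OF _ lower] inverse_scale_pos_eq[OF \<tau>] n by auto
    show "c / 2 \<le> (INF x\<in>{x. nm x \<le> \<tau>}. measure (steps \<nu>)
        {\<omega>\<in>space (steps \<nu>). (SUP k\<in>{0..n}. nm (walk x k \<omega>)) \<le> (1 + \<gamma>) * \<tau> \<and> nm (walk x n \<omega>) \<le> \<tau>})"
    proof (intro cINF_greatest)
      show "{x. nm x \<le> \<tau>} \<noteq> {}" using \<tau> nm_0 by (metis (mono_tags) empty_iff less_imp_le mem_Collect_eq)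
      fix x assume "x \<in> {x. nm x \<le> \<tau>}"
      then have x: "nm x \<le> \<tau>" by simp
      show "c / 2 \<le> measure (steps \<nu>)
          {\<omega>\<in>space (steps \<nu>). (SUP k\<in>{0..n}. nm (walk x k \<omega>)) \<le> (1 + \<gamma>) * \<tau> \<and> nm (walk x n \<omega>) \<le> \<tau>}"
        using prob_confined[OF c n scales(1) x stay[OF n scales x] far[OF n] \<gamma>] by simp
    qed
  qed (use c \<gamma> in auto)
qed

text \<open>
  Below the threshold only finitely many pairs $(n, g)$ are concerned, and laziness makes
  $p_{2n}(g)$ positive for all of them.
\<close>

lemma full_support_lower_bound:
  assumes supp: "\<And>g. p 2 g > 0" and "c > 0" and "\<kappa> > 0"
    and low: "\<And>n g. n \<ge> n0 \<Longrightarrow> nm g \<le> \<kappa> * r (real n) \<Longrightarrow> c / W (real n) \<le> p (2 * n) g"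
  obtains c' where "c' > 0"
    and "\<And>n g. n \<ge> 1 \<Longrightarrow> nm g \<le> \<kappa> * r (real n) \<Longrightarrow> c' / W (real n) \<le> p (2 * n) g"
proof -
  define S where "S = insert c (\<Union>n\<in>{1..n0}. (\<lambda>g. W (real n) * p (2 * n) g) ` nball (\<kappa> * r (real n)))"
  have fin: "finite S" unfolding S_def using \<open>\<kappa> > 0\<close> by (auto intro!: finite_nball mult_pos_pos r_pos)
  have pos: "s > 0" if "s \<in> S" for s
  proof -
    have "p (2 * n) g > 0" if "n \<ge> 1" for n g
    proof -
      have "0 < pmf \<nu> 0 ^ (2 * n - 2) * p 2 g" using lazy supp by simp
      also have "\<dots> \<le> p (2 + (2 * n - 2)) g" by (rule conv_power_hold)
      also have "2 + (2 * n - 2) = 2 * n" using that by simp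
      finally show ?thesis .
    qed
    then show ?thesis using that \<open>c > 0\<close> by (auto simp: S_def W_pos)
  qed
  show ?thesis
  proof (rule that[of "Min S"])
    show "Min S > 0" using fin pos by (simp add: S_def)
    fix n g assume n: "n \<ge> 1" and g: "nm g \<le> \<kappa> * r (real n)"
    have W: "W (real n) > 0" using n by (simp add: W_pos)
    show "Min S / W (real n) \<le> p (2 * n) g"
    proof (cases "n \<le> n0")
      case True
      then have "Min S \<le> W (real n) * p (2 * n) g"
        using n g fin by (intro Min_le) (auto simp: S_def nball_def)
      then show ?thesis using W by (simp add: pos_divide_le_eq mult.commute)
    next
      case False
      have "Min S \<le> c" using fin by (intro Min_le) (auto simp: S_def)
      then have "Min S / W (real n) \<le> c / W (real n)" using W by (intro divide_right_mono) auto
      also have "\<dots> \<le> p (2 * n) g" using False g by (intro low) auto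
      finally show ?thesis .
    qed
  qed
qed

end

theorem proposition3p5:
  fixes nm :: "'a::group_add \<Rightarrow> real" and r :: "real \<Rightarrow> real" and \<nu> :: "'a pmf"
  assumes "group_norm nm"
    and "doubling (volume_fun nm)"
    and "well_connected nm"
    and "scale_function r"
    and "doubling r"
    and "symmetric_pmf \<nu>"
    and "controlled nm r \<nu>"
    and "pmf \<nu> 0 > 0"
    and "pseudo_poincare nm r \<nu>"
  shows "(\<exists>n0. strongly_controlled_from n0 nm r \<nu>) \<and>
         ((\<forall>g. pmf (conv_power 2 \<nu>) g > 0) \<longrightarrow> strongly_controlled nm r \<nu>)"
proof -
  interpret normed_walk \<nu> nm r
    using assms unfolding controlled_def by unfold_locales auto
  have tight: "\<exists>\<gamma>>0. \<forall>n\<ge>1. measure (steps \<nu>)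
      {\<omega>\<in>space (steps \<nu>). (SUP k\<in>{0..n}. nm (walk 0 k \<omega>)) \<ge> \<gamma> * r (real n)} \<le> \<epsilon>" if "\<epsilon> > 0" for \<epsilon>
    using assms(7) that unfolding controlled_def by blast
  obtain \<delta> c where near: "\<delta> > 0" "c > 0"
    "\<And>n g. n \<ge> 1 \<Longrightarrow> nm g \<le> \<delta> * r (real n) \<Longrightarrow> c / W (real n) \<le> p (2 * n) g"
    using near_diagonal[OF assms(9)] by blast
  have full: "\<exists>n0 c. n0 \<ge> 1 \<and> c > 0 \<and>
      (\<forall>n g. n \<ge> n0 \<longrightarrow> nm g \<le> \<kappa> * r (real n) \<longrightarrow> c / W (real n) \<le> p (2 * n) g)" if "\<kappa> > 0" for \<kappa>
    using full_lower_bound[OF assms(3) near that] by metis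
  then obtain n0 where n0: "\<And>\<kappa>. \<kappa> > 0 \<Longrightarrow> \<exists>c>0. \<forall>n g. n \<ge> n0 \<kappa> \<longrightarrow>
      nm g \<le> \<kappa> * r (real n) \<longrightarrow> c / W (real n) \<le> p (2 * n) g"
    by metis
  obtain C where C: "C > 0" "\<And>n. n \<ge> 1 \<Longrightarrow> p (2 * n) 0 \<le> C / W (real n)"
    using on_diagonal_bounds by metis
  have strong: "strongly_controlled_from k nm r \<nu>"
    if low: "\<And>\<kappa>. \<kappa> > 0 \<Longrightarrow> \<exists>c>0. \<forall>n\<ge>1. \<forall>g. k \<kappa> \<le> n \<longrightarrow>
      nm g \<le> \<kappa> * r (real n) \<longrightarrow> c / W (real n) \<le> p (2 * n) g" for k
    unfolding strongly_controlled_from_def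
  proof (rule conjI[OF exI[of _ C] confinement], intro conjI allI impI)
    fix \<kappa> :: real assume "\<kappa> > 0"
    from low[OF this] obtain c where c: "c > 0" "\<And>n g. n \<ge> 1 \<Longrightarrow> k \<kappa> \<le> n \<Longrightarrow>
      nm g \<le> \<kappa> * r (real n) \<Longrightarrow> c / W (real n) \<le> p (2 * n) g" by blast
    have "p (2 * n) g \<le> C / W (real n)" if "n \<ge> 1" for n g
      using p_even_le[of n g] C(2)[OF that] by linarith
    with c show "\<exists>c>0. \<forall>n\<ge>1. \<forall>g. nm g \<le> \<kappa> * r (real n) \<longrightarrow>
        (k \<kappa> \<le> n \<longrightarrow> c * inverse (V (r (real n))) \<le> p (2 * n) g) \<and>
        p (2 * n) g \<le> C * inverse (V (r (real n)))"
      by (auto simp: W_def divide_inverse intro!: exI[of _ c])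
  qed (use C(1) full tight in blast)+
  show ?thesis
  proof (intro conjI impI exI)
    show "strongly_controlled_from n0 nm r \<nu>" using n0 by (intro strong) blast
    assume supp: "\<forall>g. pmf (conv_power 2 \<nu>) g > 0"
    show "strongly_controlled nm r \<nu>"
      unfolding strongly_controlled_def
    proof (rule strong)
      fix \<kappa> :: real assume \<kappa>: "\<kappa> > 0"
      obtain c where c: "c > 0" "\<And>n g. n \<ge> n0 \<kappa> \<Longrightarrow>
        nm g \<le> \<kappa> * r (real n) \<Longrightarrow> c / W (real n) \<le> p (2 * n) g"
        using n0[OF \<kappa>] by blast
      obtain c' where "c' > 0" "\<And>n g. n \<ge> 1 \<Longrightarrow>
        nm g \<le> \<kappa> * r (real n) \<Longrightarrow> c' / W (real n) \<le> p (2 * n) g"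
        using full_support_lower_bound[OF _ c(1) \<kappa> c(2)] supp by blast
      then show "\<exists>c>0. \<forall>n\<ge>1. \<forall>g. 1 \<le> n \<longrightarrow>
        nm g \<le> \<kappa> * r (real n) \<longrightarrow> c / W (real n) \<le> p (2 * n) g" by blast
    qed
  qed
qed

end
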